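(* For every $k\ge 1$, there is an algorithm which, given a finite set $S\subseteq \mathcal{T}_k$, decides whether $(\operatorname{Forb}_\preceq(S),\preceq)$ has the joint embedding property. More generally, there is an algorithm which, given a (deterministic, bottom-up) tree automaton recognizing a tree language $L\subseteq\mathcal{T}_k$, decides whether $(L,\preceq)$ has the joint embedding property.
   Context: A "tree" means a finite, rooted, labeled binary tree (every vertex has either $0$ or $2$ children, children unordered), each vertex carrying a label from a finite label set; $\mathcal{T}_k$ is the set of such trees with $k$ possible labels. A tree $T$ contains $U$ topologically, written $U\preceq T$, if $U$ (including its root and labels) can be obtained from $T$ by a sequence of edge contractions and vertex/edge deletions, where the vertex resulting from contracting an edge gets the label of the parent endpoint; equivalently, there is an injection $\phi:V(U)\to V(T)$ such that the paths in $T$ from $\phi(u)$ to $\phi(v)$, $uv\in E(U)$, are edge-disjoint, contracting these paths to edges and deleting all vertices not on them yields $U$, and $v$ is a descendant of $u$ in $U$ iff $\phi(v)$ is a descendant of $\phi(u)$ in $T$. For a partially ordered set $(\mathcal{F},\le)$ and $S\subseteq\mathcal{F}$, $\operatorname{Forb}_\le(S)=\{X\in\mathcal{F}: Y\not\le X\text{ for all }Y\in S\}$. A poset $(\mathcal{F},\le)$ has the joint embedding property (JEP) if for all $X_1,X_2\in\mathcal{F}$ there is $Y\in\mathcal{F}$ with $X_1\le Y$ and $X_2\le Y$. A deterministic bottom-up tree automaton consists of a finite label set $\Lambda$, a finite state set $\Sigma$, accepting states $\Sigma_a\subseteq\Sigma$, and maps $m_0:\Lambda\to\Sigma$, $m_2:\Lambda\times\Sigma^2\to\Sigma$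 with $m_2(x,y,z)=m_2(x,z,y)$; it assigns to each vertex $u$ the state $m_0(\lambda_u)$ if $u$ is a leaf and $m_2(\lambda_u,\sigma(v_1),\sigma(v_2))$ if $u$ has children $v_1,v_2$ ($\lambda_u$ the label of $u$), and accepts the tree iff the root's state lies in $\Sigma_a$. It recognizes the language of trees it accepts; such languages are called regular tree languages. *)

theory Defs
  imports "HOL-Library.Nat_Bijection" "HOL-Library.Sublist"
begin

section \<open>Labelled binary trees and topological containment\<close>

text \<open>
  A tree whose children are unordered is represented by any of its plane drawings. Two values
  denote the same unordered tree iff they are related by \<open>tree_iso\<close> below; containment and
  acceptance do not distinguish such values (lemmas \<open>contains_iso\<close> and \<open>run_iso\<close>).
\<close>

datatype (labels: 'a) btree = Leaf 'a | Node 'a "'a btree" "'a btree"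

definition trees :: "nat \<Rightarrow> nat btree set" where
  "trees k = {T. labels T \<subseteq> {..<k}}"

text \<open>A vertex is the sequence of left (\<open>False\<close>) and right (\<open>True\<close>) moves leading to it from the root.\<close>

type_synonym vertex = "bool list"

fun verts :: "'a btree \<Rightarrow> vertex set" where
  "verts (Leaf a) = {[]}"
| "verts (Node a l r) = insert [] ((#) False ` verts l \<union> (#) True ` verts r)"

fun label_at :: "'a btree \<Rightarrow> vertex \<Rightarrow> 'a" where
  "label_at (Leaf a) p = a"
| "label_at (Node a l r) [] = a"
| "label_at (Node a l r) (b # p) = label_at (if b then r else l) p"

definition edges :: "'a btree \<Rightarrow> (vertex \<times> vertex) set" where
  "edges T = {(u, v). u \<in> verts T \<and> v \<in> verts T \<and> (\<exists>b. v = u @ [b])}"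

text \<open>\<open>v\<close> is a descendant of \<open>u\<close> iff \<open>prefix u v\<close>. For such \<open>u\<close> and \<open>v\<close>, these are the edges on the
  path from \<open>u\<close> to \<open>v\<close>.\<close>

definition path_edges :: "'a btree \<Rightarrow> vertex \<Rightarrow> vertex \<Rightarrow> (vertex \<times> vertex) set" where
  "path_edges T u v = {(x, y) \<in> edges T. prefix u x \<and> prefix y v}"

text \<open>
  That contracting the paths to edges and deleting the remaining vertices yields \<open>U\<close> amounts, given
  the other conditions, to the agreement of labels: edge-disjoint downward paths cannot share an
  inner vertex, because its parent edge would be shared, and no image of a vertex of \<open>U\<close> is an inner
  vertex of a path, by the condition on descendants. The image of the root of \<open>U\<close> need not be the
  root of \<open>T\<close>, and the image of a leaf of \<open>U\<close> need not be a leaf of \<open>T\<close>.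
\<close>

definition topological_embedding :: "'a btree \<Rightarrow> 'a btree \<Rightarrow> (vertex \<Rightarrow> vertex) \<Rightarrow> bool" where
  "topological_embedding U T \<phi> \<longleftrightarrow>
     inj_on \<phi> (verts U) \<and> \<phi> ` verts U \<subseteq> verts T \<and>
     (\<forall>u\<in>verts U. label_at T (\<phi> u) = label_at U u) \<and>
     (\<forall>u\<in>verts U. \<forall>v\<in>verts U. prefix u v \<longleftrightarrow> prefix (\<phi> u) (\<phi> v)) \<and>
     (\<forall>(u, v)\<in>edges U. \<forall>(u', v')\<in>edges U. (u, v) \<noteq> (u', v') \<longrightarrow>
        path_edges T (\<phi> u) (\<phi> v) \<inter> path_edges T (\<phi> u') (\<phi> v') = {})"

definition contains :: "'a btree \<Rightarrow> 'a btree \<Rightarrow> bool"  (infix "\<preceq>" 50) where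
  "U \<preceq> T \<longleftrightarrow> (\<exists>\<phi>. topological_embedding U T \<phi>)"

definition Forb :: "('a \<Rightarrow> 'a \<Rightarrow> bool) \<Rightarrow> 'a set \<Rightarrow> 'a set \<Rightarrow> 'a set" where
  "Forb le F S = {X \<in> F. \<forall>Y\<in>S. \<not> le Y X}"

definition joint_embedding_property :: "('a \<Rightarrow> 'a \<Rightarrow> bool) \<Rightarrow> 'a set \<Rightarrow> bool" where
  "joint_embedding_property le F \<longleftrightarrow> (\<forall>X1\<in>F. \<forall>X2\<in>F. \<exists>Y\<in>F. le X1 Y \<and> le X2 Y)"


section \<open>Tree automata\<close>

text \<open>The labels are \<open>{..<k}\<close> and the states \<open>{..<num_states A}\<close>; values of the transition maps
  outside these sets are irrelevant.\<close>

record automaton =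
  num_states :: nat
  accepting :: "nat set"
  m0 :: "nat \<Rightarrow> nat"
  m2 :: "nat \<Rightarrow> nat \<Rightarrow> nat \<Rightarrow> nat"

definition tree_automaton :: "nat \<Rightarrow> automaton \<Rightarrow> bool" where
  "tree_automaton k A \<longleftrightarrow>
     accepting A \<subseteq> {..<num_states A} \<and>
     (\<forall>x<k. m0 A x < num_states A) \<and>
     (\<forall>x<k. \<forall>y<num_states A. \<forall>z<num_states A.
        m2 A x y z < num_states A \<and> m2 A x y z = m2 A x z y)"

fun run :: "automaton \<Rightarrow> nat btree \<Rightarrow> nat" where
  "run A (Leaf x) = m0 A x"
| "run A (Node x l r) = m2 A x (run A l) (run A r)"

definition language :: "nat \<Rightarrow> automaton \<Rightarrow> nat btree set" where
  "language k A = {T \<in> trees k. run A T \<in> accepting A}"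


section \<open>Decidability\<close>

text \<open>
  \<open>recursive_fn n f\<close>: on lists of length \<open>n\<close>, \<open>f\<close> is a total recursive function of \<open>n\<close> arguments.
  Minimisation is applied to regular functions only, so that partial functions are not needed; by
  Kleene's normal form theorem this yields all total recursive functions.
\<close>

inductive recursive_fn :: "nat \<Rightarrow> (nat list \<Rightarrow> nat) \<Rightarrow> bool" where
  zero: "recursive_fn n (\<lambda>_. 0)"
| succ: "recursive_fn 1 (\<lambda>xs. Suc (xs ! 0))"
| proj: "i < n \<Longrightarrow> recursive_fn n (\<lambda>xs. xs ! i)"
| comp: "recursive_fn (length gs) f \<Longrightarrow> (\<And>g. g \<in> set gs \<Longrightarrow> recursive_fn n g) \<Longrightarrow>
    recursive_fn n (\<lambda>xs. f (map (\<lambda>g. g xs) gs))"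
| prim_rec: "recursive_fn n f \<Longrightarrow> recursive_fn (Suc (Suc n)) g \<Longrightarrow>
    recursive_fn (Suc n) (\<lambda>xs. rec_nat (f (tl xs)) (\<lambda>i r. g (i # r # tl xs)) (hd xs))"
| minim: "recursive_fn (Suc n) f \<Longrightarrow> (\<And>xs. length xs = n \<Longrightarrow> \<exists>y. f (y # xs) = 0) \<Longrightarrow>
    recursive_fn n (\<lambda>xs. LEAST y. f (y # xs) = 0)"

text \<open>
  The decision problem with instances \<open>D\<close>, presented to the algorithm through the encoding \<open>enc\<close>,
  and with yes-instances those satisfying \<open>P\<close>. Nothing is required on numbers that do not encode
  an instance.
\<close>

definition decidable :: "('i \<Rightarrow> nat) \<Rightarrow> 'i set \<Rightarrow> ('i \<Rightarrow> bool) \<Rightarrow> bool" where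
  "decidable enc D P \<longleftrightarrow>
     (\<exists>f. recursive_fn 1 f \<and> (\<forall>x\<in>D. f [enc x] = (if P x then 1 else 0)))"

fun tree_encode :: "nat btree \<Rightarrow> nat" where
  "tree_encode (Leaf x) = 2 * x"
| "tree_encode (Node x l r) =
     2 * prod_encode (x, prod_encode (tree_encode l, tree_encode r)) + 1"

definition tree_set_encode :: "nat btree set \<Rightarrow> nat" where
  "tree_set_encode S = set_encode (tree_encode ` S)"

definition automaton_encode :: "nat \<Rightarrow> automaton \<Rightarrow> nat" where
  "automaton_encode k A = (let n = num_states A in
     list_encode
       [n,
        set_encode (accepting A),
        list_encode (map (m0 A) [0..<k]),
        list_encode (map (\<lambda>(x, y, z). m2 A x y z)
          (List.product [0..<k] (List.product [0..<n] [0..<n])))])"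


section \<open>Independence of the order of children, and faithfulness of the encodings\<close>

inductive tree_iso :: "'a btree \<Rightarrow> 'a btree \<Rightarrow> bool" where
  leaf: "tree_iso (Leaf a) (Leaf a)"
| keep: "tree_iso l l' \<Longrightarrow> tree_iso r r' \<Longrightarrow> tree_iso (Node a l r) (Node a l' r')"
| swap: "tree_iso l r' \<Longrightarrow> tree_iso r l' \<Longrightarrow> tree_iso (Node a l r) (Node a l' r')"

lemma tree_iso_sym: "tree_iso T T' \<Longrightarrow> tree_iso T' T"
  by (induction rule: tree_iso.induct) (auto intro: tree_iso.intros)

lemma labels_iso: "tree_iso T T' \<Longrightarrow> labels T = labels T'"
  by (induction rule: tree_iso.induct) auto

lemma run_less:
  "tree_automaton k A \<Longrightarrow> T \<in> trees k \<Longrightarrow> run A T < num_states A"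
  by (induction T) (auto simp: tree_automaton_def trees_def)

lemma run_iso:
  assumes "tree_automaton k A"
  shows "tree_iso T T' \<Longrightarrow> T \<in> trees k \<Longrightarrow> run A T = run A T'"
proof (induction rule: tree_iso.induct)
  case (swap l r' r l' a)
  then have "l \<in> trees k" "r \<in> trees k" "a < k" by (auto simp: trees_def)
  with swap assms run_less[OF assms] show ?case by (simp add: tree_automaton_def) metis
qed (auto simp: trees_def)

lemma edge_on_path:
  assumes e: "topological_embedding V T \<psi>" and v: "v \<in> verts V" and pre: "prefix u v"
    and closed: "\<And>x. prefix x v \<Longrightarrow> x \<in> verts V"
    and ab: "(a, b) \<in> path_edges T (\<psi> u) (\<psi> v)"
  shows "\<exists>x y. (x, y) \<in> path_edges V u v \<and> (a, b) \<in> path_edges T (\<psi> x) (\<psi> y)"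
  using v pre closed ab
proof (induction v rule: rev_induct)
  case Nil
  then show ?case
    by (auto simp: path_edges_def edges_def prefix_def)
next
  case (snoc c w)
  show ?case
  proof (cases "u = w @ [c]")
    case True
    with snoc.prems show ?thesis by (auto simp: path_edges_def edges_def prefix_def)
  next
    case False
    then have uw: "prefix u w" using snoc.prems(2) by simp
    have w: "w \<in> verts V" using snoc.prems(3) by simp
    have len: "prefix (\<psi> w) (\<psi> (w @ [c]))"
      using e w snoc.prems(1) unfolding topological_embedding_def by (meson prefixI)
    have abT: "(a, b) \<in> edges T" "prefix (\<psi> u) a" "prefix b (\<psi> (w @ [c]))"
      using snoc.prems(4) by (auto simp: path_edges_def)
    then obtain d where d: "b = a @ [d]" by (auto simp: edges_def)
    show ?thesis
    proof (cases "prefix (\<psi> w) a")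
      case True
      have "(w, w @ [c]) \<in> path_edges V u (w @ [c])"
        using uw w snoc.prems(1) by (auto simp: path_edges_def edges_def)
      with True abT show ?thesis by (auto simp: path_edges_def)
    next
      case False
      have "prefix b (\<psi> w)"
        using False len abT(3) d by (metis prefix_same_cases prefix_snoc)
      then have "(a, b) \<in> path_edges T (\<psi> u) (\<psi> w)" using abT by (auto simp: path_edges_def)
      then obtain x y where "(x, y) \<in> path_edges V u w" "(a, b) \<in> path_edges T (\<psi> x) (\<psi> y)"
        using snoc.IH[OF w uw] snoc.prems(3) by auto
      then show ?thesis by (auto simp: path_edges_def)
    qed
  qed
qed

lemma verts_prefix: "v \<in> verts T \<Longrightarrow> prefix x v \<Longrightarrow> x \<in> verts T"
  by (induction T arbitrary: v x) (auto simp: prefix_Cons)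

lemma contains_refl: "T \<preceq> T"
proof -
  have "path_edges T u v = {(u, v)}" if "(u, v) \<in> edges T" for u v
    using that by (auto simp: path_edges_def edges_def prefix_def Cons_eq_append_conv)
  then have "topological_embedding T T (\<lambda>x. x)"
    by (auto simp: topological_embedding_def)
  then show ?thesis unfolding contains_def by blast
qed

lemma contains_trans:
  assumes "U \<preceq> V" "V \<preceq> T" shows "U \<preceq> T"
proof -
  obtain \<phi> \<psi> where p: "topological_embedding U V \<phi>" and q: "topological_embedding V T \<psi>"
    using assms unfolding contains_def by blast
  have inV: "\<phi> u \<in> verts V" if "u \<in> verts U" for u
    using p that unfolding topological_embedding_def by blast
  have *: "\<exists>x y. (x, y) \<in> path_edges V (\<phi> u) (\<phi> v) \<and> (a, b) \<in> path_edges T (\<psi> x) (\<psi> y)"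
    if "(u, v) \<in> edges U" "(a, b) \<in> path_edges T (\<psi> (\<phi> u)) (\<psi> (\<phi> v))" for u v a b
  proof (rule edge_on_path[OF q _ _ _ that(2)])
    show "\<phi> v \<in> verts V" using that(1) inV by (auto simp: edges_def)
    then show "\<And>x. prefix x (\<phi> v) \<Longrightarrow> x \<in> verts V" by (rule verts_prefix)
    have "prefix u v" "u \<in> verts U" "v \<in> verts U" using that(1) by (auto simp: edges_def)
    then show "prefix (\<phi> u) (\<phi> v)" using p unfolding topological_embedding_def by blast
  qed
  have "topological_embedding U T (\<psi> \<circ> \<phi>)"
    unfolding topological_embedding_def
  proof (intro conjI)
    show "inj_on (\<psi> \<circ> \<phi>) (verts U)"
      using p q unfolding topological_embedding_def by (meson comp_inj_on inj_on_subset)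
    show "(\<psi> \<circ> \<phi>) ` verts U \<subseteq> verts T"
      using inV q unfolding topological_embedding_def by auto
    show "\<forall>u\<in>verts U. label_at T ((\<psi> \<circ> \<phi>) u) = label_at U u"
      using inV p q unfolding topological_embedding_def by auto
    show "\<forall>u\<in>verts U. \<forall>v\<in>verts U. prefix u v = prefix ((\<psi> \<circ> \<phi>) u) ((\<psi> \<circ> \<phi>) v)"
      using inV p q unfolding topological_embedding_def by auto
    have "path_edges T (\<psi> (\<phi> u)) (\<psi> (\<phi> v)) \<inter> path_edges T (\<psi> (\<phi> u')) (\<psi> (\<phi> v')) = {}"
      if E: "(u, v) \<in> edges U" "(u', v') \<in> edges U" and ne: "(u, v) \<noteq> (u', v')"
      for u v u' v'
    proof (rule equals0I, clarify)
      fix a b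
      assume m: "(a, b) \<in> path_edges T (\<psi> (\<phi> u)) (\<psi> (\<phi> v))"
          "(a, b) \<in> path_edges T (\<psi> (\<phi> u')) (\<psi> (\<phi> v'))"
      obtain x y where xy: "(x, y) \<in> path_edges V (\<phi> u) (\<phi> v)"
        "(a, b) \<in> path_edges T (\<psi> x) (\<psi> y)" using *[OF E(1) m(1)] by blast
      obtain x' y' where xy': "(x', y') \<in> path_edges V (\<phi> u') (\<phi> v')"
        "(a, b) \<in> path_edges T (\<psi> x') (\<psi> y')" using *[OF E(2) m(2)] by blast
      have "(x, y) \<in> edges V" "(x', y') \<in> edges V"
        using xy xy' by (auto simp: path_edges_def)
      then have "(x, y) = (x', y')"
        using q xy(2) xy'(2) unfolding topological_embedding_def by blast
      then show False
        using p E ne xy(1) xy'(1) unfolding topological_embedding_def by blast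
    qed
    then show "\<forall>(u, v)\<in>edges U. \<forall>(u', v')\<in>edges U. (u, v) \<noteq> (u', v') \<longrightarrow>
        path_edges T ((\<psi> \<circ> \<phi>) u) ((\<psi> \<circ> \<phi>) v) \<inter>
        path_edges T ((\<psi> \<circ> \<phi>) u') ((\<psi> \<circ> \<phi>) v') = {}"
      by (clarify, unfold comp_def) blast
  qed
  then show ?thesis unfolding contains_def by blast
qed


lemma contains_Node:
  fixes s :: bool
  assumes "l \<preceq> (if s then r' else l')" "r \<preceq> (if s then l' else r')"
  shows "Node a l r \<preceq> Node a l' r'"
proof -
  define ch where "ch b = (if b then r else l)" for b
  define ch' where "ch' b = (if b = s then l' else r')" for b
  have "\<exists>g. topological_embedding (ch b) (ch' b) g" for b
    using assms by (cases s; cases b) (auto simp: ch_def ch'_def contains_def)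
  then obtain g where g: "\<And>b. topological_embedding (ch b) (ch' b) (g b)" by metis
  define \<phi> where "\<phi> p = (case p of [] \<Rightarrow> [] | b # q \<Rightarrow> (b \<noteq> s) # g b q)" for p
  have \<phi>: "\<phi> [] = []" "\<And>b q. \<phi> (b # q) = (b \<noteq> s) # g b q" by (simp_all add: \<phi>_def)
  let ?U = "Node a l r" and ?T = "Node a l' r'"
  have vU: "x \<in> verts ?U \<longleftrightarrow> x = [] \<or> (\<exists>b q. x = b # q \<and> q \<in> verts (ch b))" for x
    by (auto simp: ch_def)
  have vT: "(b \<noteq> s) # q \<in> verts ?T \<longleftrightarrow> q \<in> verts (ch' b)" for b q
    by (auto simp: ch'_def)
  have lU: "label_at ?U (b # q) = label_at (ch b) q" for b q by (simp add: ch_def)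
  have lT: "label_at ?T ((b \<noteq> s) # q) = label_at (ch' b) q" for b q by (simp add: ch'_def)
  have ginj: "inj_on (g b) (verts (ch b))"
    and gin: "x \<in> verts (ch b) \<Longrightarrow> g b x \<in> verts (ch' b)"
    and glab: "x \<in> verts (ch b) \<Longrightarrow> label_at (ch' b) (g b x) = label_at (ch b) x"
    and gpre: "x \<in> verts (ch b) \<Longrightarrow> y \<in> verts (ch b) \<Longrightarrow>
      prefix (g b x) (g b y) \<longleftrightarrow> prefix x y"
    for b x y using g[of b] unfolding topological_embedding_def by auto
  have gdis: "(x, y) = (x', y')"
    if "(x, y) \<in> edges (ch b)" "(x', y') \<in> edges (ch b)"
      "e \<in> path_edges (ch' b) (g b x) (g b y)" "e \<in> path_edges (ch' b) (g b x') (g b y')"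
    for b x y x' y' e using g[of b] that unfolding topological_embedding_def by blast
  have eU: "\<exists>b. (u = [] \<and> v = [b]) \<or> (\<exists>x y. u = b # x \<and> v = b # y \<and> (x, y) \<in> edges (ch b))"
    if "(u, v) \<in> edges ?U" for u v
    using that unfolding edges_def by (cases u) (auto simp: ch_def)
  have nil: "[] \<in> verts (ch b)" for b by (cases "ch b") auto
  have up: "(u = [] \<and> v = [b] \<and> (p = [] \<or> (\<exists>p'. p = (b \<noteq> s) # p' \<and> prefix q' (g b []) \<and>
        (p', q') \<in> edges (ch' b)))) \<or>
      (\<exists>x y p'. u = b # x \<and> v = b # y \<and> (x, y) \<in> edges (ch b) \<and> p = (b \<noteq> s) # p' \<and>
        (p', q') \<in> path_edges (ch' b) (g b x) (g b y))"
    if "(u, v) \<in> edges ?U" "(p, (b \<noteq> s) # q') \<in> path_edges ?T (\<phi> u) (\<phi> v)" for u v p q' b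
  proof -
    note uv = that(1)
    have e: "(p, (b \<noteq> s) # q') \<in> edges ?T" and pp: "prefix (\<phi> u) p"
      and qq: "prefix ((b \<noteq> s) # q') (\<phi> v)"
      using that(2) by (auto simp: path_edges_def)
    have pc: "p = [] \<or> (\<exists>p'. p = (b \<noteq> s) # p' \<and> (p', q') \<in> edges (ch' b))"
      using e vT unfolding edges_def by (cases p) fastforce+
    obtain c where "(u = [] \<and> v = [c]) \<or>
        (\<exists>x y. u = c # x \<and> v = c # y \<and> (x, y) \<in> edges (ch c))"
      using eU[OF uv] by blast
    moreover from this have "c = b" using qq by (cases s) (auto simp: \<phi>)
    ultimately show ?thesis using pc pp qq by (auto simp: \<phi> path_edges_def)
  qed
  have apart: False
    if "(x, y) \<in> edges (ch b)" "(p', q') \<in> path_edges (ch' b) (g b x) (g b y)" "prefix q' (g b [])"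
    for b x y p' q'
  proof -
    have "prefix (g b []) (g b x)" using that(1) nil by (auto simp: gpre edges_def)
    moreover have "prefix (g b x) p'" "strict_prefix p' q'"
      using that(2) by (auto simp: path_edges_def edges_def strict_prefix_def)
    ultimately show False using that(3)
      by (meson prefix_order.less_le_not_le prefix_order.order_trans)
  qed
  have "topological_embedding ?U ?T \<phi>"
    unfolding topological_embedding_def
  proof (intro conjI)
    show "inj_on \<phi> (verts ?U)"
      using ginj unfolding inj_on_def Ball_def vU by (cases s) (auto simp: \<phi>)
    show "\<phi> ` verts ?U \<subseteq> verts ?T"
    proof
      fix y assume "y \<in> \<phi> ` verts ?U"
      then obtain x where "x \<in> verts ?U" "y = \<phi> x" by blast
      then show "y \<in> verts ?T" using vT gin unfolding vU by (auto simp: \<phi> simp del: verts.simps) auto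
    qed
    show "\<forall>u\<in>verts ?U. label_at ?T (\<phi> u) = label_at ?U u"
      unfolding Ball_def vU using glab lU lT by (auto simp: \<phi> simp del: label_at.simps(3))
    show "\<forall>u\<in>verts ?U. \<forall>v\<in>verts ?U. prefix u v \<longleftrightarrow> prefix (\<phi> u) (\<phi> v)"
      unfolding Ball_def vU by (cases s) (auto simp: \<phi> gpre)
    have "path_edges ?T (\<phi> u) (\<phi> v) \<inter> path_edges ?T (\<phi> u') (\<phi> v') = {}"
      if E: "(u, v) \<in> edges ?U" "(u', v') \<in> edges ?U" and ne: "(u, v) \<noteq> (u', v')" for u v u' v'
    proof (rule equals0I, clarify)
      fix p q
      assume m: "(p, q) \<in> path_edges ?T (\<phi> u) (\<phi> v)" "(p, q) \<in> path_edges ?T (\<phi> u') (\<phi> v')"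
      then obtain d q' where "q = d # q'" by (cases q) (auto simp: path_edges_def edges_def)
      then have "q = ((d \<noteq> s) \<noteq> s) # q'" by auto
      then obtain b where q: "q = (b \<noteq> s) # q'" by blast
      show False
        using up[OF E(1) m(1)[unfolded q]] up[OF E(2) m(2)[unfolded q]] ne gdis[of _ _ b] apart[of _ _ b]
        by blast
    qed
    then show "\<forall>(u, v)\<in>edges ?U. \<forall>(u', v')\<in>edges ?U. (u, v) \<noteq> (u', v') \<longrightarrow>
        path_edges ?T (\<phi> u) (\<phi> v) \<inter> path_edges ?T (\<phi> u') (\<phi> v') = {}"
      by clarify blast
  qed
  then show ?thesis unfolding contains_def by blast
qed

lemma tree_iso_contains: "tree_iso T T' \<Longrightarrow> T \<preceq> T'"
proof (induction rule: tree_iso.induct)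
  case (leaf a)
  show ?case by (rule contains_refl)
next
  case keep
  then show ?case using contains_Node[where s = False] by simp
next
  case swap
  then show ?case using contains_Node[where s = True] by simp
qed

lemma contains_iso:
  assumes "tree_iso U U'" "tree_iso T T'"
  shows "U \<preceq> T \<longleftrightarrow> U' \<preceq> T'"
  using assms by (meson contains_trans tree_iso_contains tree_iso_sym)

lemma inj_tree_encode: "inj tree_encode"
proof
  show "x = y" if "tree_encode x = tree_encode y" for x y
    using that
  proof (induction x arbitrary: y)
    case (Leaf a)
    then show ?case by (cases y) (simp_all add: Suc_double_not_eq_double double_not_eq_Suc_double)
  next
    case (Node a l r)
    then show ?case by (cases y) (auto simp: Suc_double_not_eq_double double_not_eq_Suc_double)
  qed
qed

lemma inj_on_tree_set_encode: "inj_on tree_set_encode {S. finite S}"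
  unfolding inj_on_def tree_set_encode_def
  by (metis finite_imageI inj_image_eq_iff inj_tree_encode mem_Collect_eq set_encode_eq)

lemma automaton_encode_eq:
  assumes "tree_automaton k A" "tree_automaton k B"
    and "automaton_encode k A = automaton_encode k B"
  shows "num_states A = num_states B" "accepting A = accepting B"
    "x < k \<Longrightarrow> m0 A x = m0 B x"
    "x < k \<Longrightarrow> y < num_states A \<Longrightarrow> z < num_states A \<Longrightarrow> m2 A x y z = m2 B x y z"
proof -
  have fin: "finite (accepting A)" "finite (accepting B)"
    using assms(1,2) by (auto simp: tree_automaton_def intro: finite_subset)
  show n: "num_states A = num_states B" and "accepting A = accepting B"
    and "x < k \<Longrightarrow> m0 A x = m0 B x"
    using assms(3) fin by (auto simp: automaton_encode_def Let_def list_encode_eq set_encode_eq)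
  show "x < k \<Longrightarrow> y < num_states A \<Longrightarrow> z < num_states A \<Longrightarrow> m2 A x y z = m2 B x y z"
    using assms(3) n by (auto simp: automaton_encode_def Let_def list_encode_eq)
qed

end

theory Submission
  imports Defs
begin

text \<open>
  Call a set of trees an ideal if it is downward closed and directed for containment. A language has
  the joint embedding property iff it lies in a single ideal below it. For a state \<open>q\<close> of the
  automaton let \<open>below q\<close> be the set of trees contained in some tree with state \<open>q\<close>; it depends only
  on the strongly connected component of \<open>q\<close> in the graph of transitions. If some transition stays in
  this component from both children, \<open>below q\<close> is directed, because any two trees can be placed under
  a common node. Otherwise every tree with state \<open>q\<close> is a spine whose vertices have states in the
  component, with side trees from lower components, ending in a node over two lower trees. Enclosing
  the latter in ideals \<open>I\<close> and \<open>J\<close>, the set of spines over nodes with children in \<open>I\<close> and \<open>J\<close> is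
  again an ideal, as spines can be stacked in any order. So every \<open>below q\<close> is a union of finitely
  many ideals, whose number is bounded by a primitive recursive function of the automaton, and they
  are all recognised by bottom-up automata. By pumping, a language not inside a given ideal has a
  small tree outside it. Hence the property holds iff one tree of the language contains all small
  trees of the language, and by pumping again this tree can be bounded as well. Thus the property
  is equivalent to a statement on codes of trees with bounded quantifiers only. For \<open>Forb\<close>, the
  set of trees with code below that of \<open>S\<close> that are contained in a tree serves as the state.
\<close>

section \<open>Containment by recursion\<close>

lemma Nil_in_verts [simp]: "[] \<in> verts T"
  by (cases T) auto

lemma topological_embedding_disjoint:
  assumes "topological_embedding U T \<phi>" "(u, v) \<in> edges U" "(u', v') \<in> edges U"
    "(u, v) \<noteq> (u', v')"
  shows "path_edges T (\<phi> u) (\<phi> v) \<inter> path_edges T (\<phi> u') (\<phi> v') = {}"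
proof -
  have "\<forall>(u, v)\<in>edges U. \<forall>(u', v')\<in>edges U. (u, v) \<noteq> (u', v') \<longrightarrow>
      path_edges T (\<phi> u) (\<phi> v) \<inter> path_edges T (\<phi> u') (\<phi> v') = {}"
    using assms(1) unfolding topological_embedding_def by (elim conjE)
  from this[THEN bspec, OF assms(2), unfolded prod.case, THEN bspec, OF assms(3), unfolded prod.case]
  show ?thesis using assms(4) by (rule mp)
qed

lemma topological_embedding_subtree:
  assumes e: "topological_embedding (Node a U0 U1) T \<phi>"
  shows "topological_embedding (if b then U1 else U0) T (\<lambda>p. \<phi> (b # p))"
proof -
  let ?U = "Node a U0 U1" and ?V = "if b then U1 else U0"
  have v: "p \<in> verts ?V \<Longrightarrow> b # p \<in> verts ?U" for p by (cases b) auto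
  have l: "label_at ?U (b # p) = label_at ?V p" for p by simp
  have ed: "(p, q) \<in> edges ?V \<Longrightarrow> (b # p, b # q) \<in> edges ?U" for p q
    using v by (auto simp: edges_def simp del: verts.simps)
  note e' = e[unfolded topological_embedding_def]
  have einj: "inj_on \<phi> (verts ?U)" and ein: "p \<in> verts ?U \<Longrightarrow> \<phi> p \<in> verts T"
    and elab: "p \<in> verts ?U \<Longrightarrow> label_at T (\<phi> p) = label_at ?U p"
    and epre: "p \<in> verts ?U \<Longrightarrow> q \<in> verts ?U \<Longrightarrow> prefix p q \<longleftrightarrow> prefix (\<phi> p) (\<phi> q)" for p q
    using e' by (blast, blast, blast, blast)
  show ?thesis
    unfolding topological_embedding_def
  proof (intro conjI)
    show "inj_on (\<lambda>p. \<phi> (b # p)) (verts ?V)"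
    proof (rule inj_onI)
      fix x y assume "x \<in> verts ?V" "y \<in> verts ?V" "\<phi> (b # x) = \<phi> (b # y)"
      then have "b # x = b # y" using v einj by (meson inj_onD)
      then show "x = y" by simp
    qed
    show "(\<lambda>p. \<phi> (b # p)) ` verts ?V \<subseteq> verts T" using ein v by blast
    show "\<forall>u\<in>verts ?V. label_at T (\<phi> (b # u)) = label_at ?V u"
      using elab v l by simp
    show "\<forall>u\<in>verts ?V. \<forall>w\<in>verts ?V. prefix u w = prefix (\<phi> (b # u)) (\<phi> (b # w))"
    proof (intro ballI)
      fix u w assume "u \<in> verts ?V" "w \<in> verts ?V"
      then show "prefix u w = prefix (\<phi> (b # u)) (\<phi> (b # w))"
        using epre[OF v v, of u w] by simp
    qed
    have "path_edges T (\<phi> (b # u)) (\<phi> (b # w)) \<inter> path_edges T (\<phi> (b # u')) (\<phi> (b # w')) = {}"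
      if "(u, w) \<in> edges ?V" "(u', w') \<in> edges ?V" "(u, w) \<noteq> (u', w')" for u w u' w'
    proof -
      have "(b # u, b # w) \<noteq> (b # u', b # w')" using that(3) by simp
      with topological_embedding_disjoint[OF e ed[OF that(1)] ed[OF that(2)]] show ?thesis by simp
    qed
    then show "\<forall>(u, w)\<in>edges ?V. \<forall>(u', w')\<in>edges ?V. (u, w) \<noteq> (u', w') \<longrightarrow>
        path_edges T (\<phi> (b # u)) (\<phi> (b # w)) \<inter> path_edges T (\<phi> (b # u')) (\<phi> (b # w')) = {}"
      by clarify blast
  qed
qed

text \<open>Every vertex of \<open>U\<close> descends from its root, so all images begin with the
  move \<open>c\<close>; deleting that move gives an embedding into the child.\<close>

lemma contains_child:
  assumes e: "topological_embedding U (Node a T0 T1) \<phi>" and c: "prefix [c] (\<phi> [])"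
  shows "U \<preceq> (if c then T1 else T0)"
proof -
  let ?T = "Node a T0 T1" and ?S = "if c then T1 else T0"
  note e' = e[unfolded topological_embedding_def]
  have einj: "inj_on \<phi> (verts U)" and ein: "p \<in> verts U \<Longrightarrow> \<phi> p \<in> verts ?T"
    and elab: "p \<in> verts U \<Longrightarrow> label_at ?T (\<phi> p) = label_at U p"
    and epre: "p \<in> verts U \<Longrightarrow> q \<in> verts U \<Longrightarrow> prefix p q \<longleftrightarrow> prefix (\<phi> p) (\<phi> q)" for p q
    using e' by auto
  define \<psi> where "\<psi> p = tl (\<phi> p)" for p
  have \<phi>: "\<phi> p = c # \<psi> p" if "p \<in> verts U" for p
  proof -
    have "prefix (\<phi> []) (\<phi> p)" using epre[of "[]" p] that by simp
    with c have "prefix [c] (\<phi> p)" by (rule prefix_order.trans)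
    then show ?thesis by (cases "\<phi> p") (auto simp: \<psi>_def)
  qed
  have v: "c # p \<in> verts ?T \<longleftrightarrow> p \<in> verts ?S" for p by (cases c) auto
  have pe: "(c # x, c # y) \<in> path_edges ?T (c # u) (c # w)" if "(x, y) \<in> path_edges ?S u w" for x y u w
    using that v by (auto simp: path_edges_def edges_def simp del: verts.simps)
  have "topological_embedding U ?S \<psi>"
    unfolding topological_embedding_def
  proof (intro conjI)
    show "inj_on \<psi> (verts U)"
    proof (rule inj_onI)
      fix x y assume "x \<in> verts U" "y \<in> verts U" "\<psi> x = \<psi> y"
      then show "x = y" using einj \<phi> by (simp add: inj_on_def)
    qed
    show "\<psi> ` verts U \<subseteq> verts ?S"
      using ein \<phi> v by (metis image_subsetI)
    show "\<forall>u\<in>verts U. label_at ?S (\<psi> u) = label_at U u"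
      using elab \<phi> by (metis label_at.simps(3))
    show "\<forall>u\<in>verts U. \<forall>w\<in>verts U. prefix u w = prefix (\<psi> u) (\<psi> w)"
      using epre \<phi> by simp
    have "path_edges ?S (\<psi> u) (\<psi> w) \<inter> path_edges ?S (\<psi> u') (\<psi> w') = {}"
      if E: "(u, w) \<in> edges U" "(u', w') \<in> edges U" and ne: "(u, w) \<noteq> (u', w')" for u w u' w'
    proof -
      have "u \<in> verts U" "w \<in> verts U" "u' \<in> verts U" "w' \<in> verts U"
        using E by (auto simp: edges_def)
      then have "(c # x, c # y) \<in> path_edges ?T (\<phi> u) (\<phi> w) \<inter> path_edges ?T (\<phi> u') (\<phi> w')"
        if "(x, y) \<in> path_edges ?S (\<psi> u) (\<psi> w) \<inter> path_edges ?S (\<psi> u') (\<psi> w')" for x y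
        using that pe \<phi> by simp
      moreover have "path_edges ?T (\<phi> u) (\<phi> w) \<inter> path_edges ?T (\<phi> u') (\<phi> w') = {}"
        using topological_embedding_disjoint[OF e E ne] .
      ultimately show ?thesis by (metis disjoint_iff emptyE ex_in_conv surj_pair)
    qed
    then show "\<forall>(u, w)\<in>edges U. \<forall>(u', w')\<in>edges U. (u, w) \<noteq> (u', w') \<longrightarrow>
        path_edges ?S (\<psi> u) (\<psi> w) \<inter> path_edges ?S (\<psi> u') (\<psi> w') = {}"
      by clarify blast
  qed
  then show ?thesis unfolding contains_def by blast
qed

lemma contains_Leaf_right [simp]: "U \<preceq> Leaf b \<longleftrightarrow> U = Leaf b"
proof
  assume "U \<preceq> Leaf b"
  then obtain \<phi> where e: "topological_embedding U (Leaf b) \<phi>" unfolding contains_def by blast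
  show "U = Leaf b"
  proof (cases U)
    case (Leaf a)
    with e show ?thesis by (auto simp: topological_embedding_def)
  next
    case (Node a l r)
    \<comment> \<open>A node has a vertex besides its root, but only one image is available, against
      injectivity.\<close>
    then have "[] \<in> verts U" "[True] \<in> verts U" by auto
    moreover have "\<phi> p = []" if "p \<in> verts U" for p
    proof -
      have "\<phi> p \<in> verts (Leaf b)" using e that unfolding topological_embedding_def by blast
      then show ?thesis by simp
    qed
    moreover have "inj_on \<phi> (verts U)" using e unfolding topological_embedding_def by blast
    ultimately have "[] = [True]" by (metis inj_onD)
    then show ?thesis by simp
  qed
qed (simp add: contains_refl)

lemma contains_Node_child: "T0 \<preceq> Node b T0 T1" "T1 \<preceq> Node b T0 T1"
proof -
  have "(if c then T1 else T0) \<preceq> Node b T0 T1" for c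
  proof -
    let ?S = "if c then T1 else T0" and ?T = "Node b T0 T1"
    have pe: "(x, y) \<in> path_edges ?T (c # u) (c # w) \<Longrightarrow>
        \<exists>x' y'. x = c # x' \<and> y = c # y' \<and> (x', y') \<in> path_edges ?S u w" for x y u w
      by (auto simp: path_edges_def edges_def prefix_Cons split: if_splits)
    have dis: "path_edges ?T (c # u) (c # w) \<inter> path_edges ?T (c # u') (c # w') = {}"
      if "path_edges ?S u w \<inter> path_edges ?S u' w' = {}" for u w u' w'
      using that by (fastforce dest: pe)
    \<comment> \<open>The path belonging to an edge is that edge alone, so distinct edges have
      disjoint paths.\<close>
    have "path_edges ?S u w = {(u, w)}" if "(u, w) \<in> edges ?S" for u w
      using that by (auto simp: path_edges_def edges_def prefix_def Cons_eq_append_conv)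
    then have "path_edges ?S u w \<inter> path_edges ?S u' w' = {}"
      if "(u, w) \<in> edges ?S" "(u', w') \<in> edges ?S" "(u, w) \<noteq> (u', w')" for u w u' w'
      using that by simp
    then have disT: "path_edges ?T (c # u) (c # w) \<inter> path_edges ?T (c # u') (c # w') = {}"
      if "(u, w) \<in> edges ?S" "(u', w') \<in> edges ?S" "(u, w) \<noteq> (u', w')" for u w u' w'
      using that by (intro dis)
    have "topological_embedding ?S ?T ((#) c)"
      unfolding topological_embedding_def
    proof (intro conjI)
      show "(#) c ` verts ?S \<subseteq> verts ?T" by (cases c) auto
      show "\<forall>(u, w)\<in>edges ?S. \<forall>(u', w')\<in>edges ?S. (u, w) \<noteq> (u', w') \<longrightarrow>
          path_edges ?T (c # u) (c # w) \<inter> path_edges ?T (c # u') (c # w') = {}"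
        by (intro ballI case_prodI2 impI disT) simp_all
    qed auto
    then show ?thesis unfolding contains_def by blast
  qed
  from this[of False] this[of True] show "T0 \<preceq> Node b T0 T1" "T1 \<preceq> Node b T0 T1" by auto
qed

lemma contains_Leaf_Node: "Leaf b \<preceq> Node b T0 T1"
proof -
  have "topological_embedding (Leaf b) (Node b T0 T1) id"
    by (auto simp: topological_embedding_def edges_def)
  then show ?thesis unfolding contains_def by blast
qed

text \<open>The recursion that replaces embeddings from here on. If the root of \<open>U\<close> is
  sent below a child, \<open>U\<close> lies in that child. If it is sent to the root,
  edge-disjointness drives the two children of \<open>U\<close> into different children, in one of
  the two orders.\<close>

lemma contains_Node_right:
  "U \<preceq> Node b T0 T1 \<longleftrightarrow> U \<preceq> T0 \<or> U \<preceq> T1 \<or> U = Leaf b \<or>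
     (\<exists>U0 U1. U = Node b U0 U1 \<and> (U0 \<preceq> T0 \<and> U1 \<preceq> T1 \<or> U0 \<preceq> T1 \<and> U1 \<preceq> T0))"
  (is "?L \<longleftrightarrow> ?R")
proof
  assume ?R
  then consider "U \<preceq> T0" | "U \<preceq> T1" | "U = Leaf b" | U0 U1 where "U = Node b U0 U1" "U0 \<preceq> T0" "U1 \<preceq> T1"
    | U0 U1 where "U = Node b U0 U1" "U0 \<preceq> T1" "U1 \<preceq> T0" by blast
  then show ?L
  proof cases
    case 1
    then show ?thesis using contains_Node_child(1) by (rule contains_trans)
  next
    case 2
    then show ?thesis using contains_Node_child(2) by (rule contains_trans)
  next
    case 3
    then show ?thesis by (simp add: contains_Leaf_Node)
  next
    case 4
    then show ?thesis using contains_Node[where s = False] by simp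
  next
    case 5
    then show ?thesis using contains_Node[where s = True] by simp
  qed
next
  let ?T = "Node b T0 T1"
  assume ?L
  then obtain \<phi> where e: "topological_embedding U ?T \<phi>" unfolding contains_def by blast
  note e' = e[unfolded topological_embedding_def]
  show ?R
  proof (cases "\<phi> []")
    case (Cons c p)
    then have "U \<preceq> (if c then T1 else T0)" using contains_child[OF e] by simp
    then show ?thesis by (auto split: if_splits)
  next
    case Nil
    have lab: "label_at U [] = b" using e' Nil by (metis Nil_in_verts label_at.simps(2))
    show ?thesis
    proof (cases U)
      case (Leaf a)
      with lab show ?thesis by simp
    next
      case (Node a U0 U1)
      have vc: "[c] \<in> verts U" for c using Node by (cases c) auto
      then have ec: "([], [c]) \<in> edges U" for c by (simp add: edges_def)
      have "\<phi> [c] \<noteq> []" for c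
        using e' Nil vc by (metis Nil_in_verts inj_onD list.distinct(1))
      \<comment> \<open>\<open>d c\<close> is the first move on the path from the root to the image
        of \<open>[c]\<close>. Both paths start at the root, so equal first moves would mean a
        common edge.\<close>
      define d where "d c = hd (\<phi> [c])" for c
      have d: "\<phi> [c] = d c # tl (\<phi> [c])" for c using \<open>\<phi> [c] \<noteq> []\<close> by (simp add: d_def)
      have pre: "prefix [d c] (\<phi> [c])" for c by (subst d) simp
      have "[d c] \<in> verts ?T" for c
      proof (rule verts_prefix)
        show "\<phi> [c] \<in> verts ?T" using e' vc[of c] by blast
        show "prefix [d c] (\<phi> [c])" by (rule pre)
      qed
      then have pd: "([], [d c]) \<in> path_edges ?T (\<phi> []) (\<phi> [c])" for c
        using pre[of c] Nil by (simp add: path_edges_def edges_def del: verts.simps)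
      have "path_edges ?T (\<phi> []) (\<phi> [False]) \<inter> path_edges ?T (\<phi> []) (\<phi> [True]) = {}"
        by (rule topological_embedding_disjoint[OF e ec ec]) simp
      then have ne: "d False \<noteq> d True" using pd[of False] pd[of True] by auto
      have "(if c then U1 else U0) \<preceq> (if d c then T1 else T0)" for c
        using contains_child[OF topological_embedding_subtree[OF e[unfolded Node], of c] pre] by simp
      from this[of False] this[of True] ne Node lab show ?thesis by (cases "d False") auto
    qed
  qed
qed

section \<open>Pumping\<close>

fun fold_btree :: "('a \<Rightarrow> 's) \<Rightarrow> ('a \<Rightarrow> 's \<Rightarrow> 's \<Rightarrow> 's) \<Rightarrow> 'a btree \<Rightarrow> 's" where
  "fold_btree f g (Leaf x) = f x"
| "fold_btree f g (Node x l r) = g x (fold_btree f g l) (fold_btree f g r)"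

fun height :: "'a btree \<Rightarrow> nat" where
  "height (Leaf x) = 0"
| "height (Node x l r) = Suc (max (height l) (height r))"

lemma Leaf_in_trees [simp]: "Leaf x \<in> trees k \<longleftrightarrow> x < k"
  by (simp add: trees_def)

lemma Node_in_trees [simp]: "Node x l r \<in> trees k \<longleftrightarrow> x < k \<and> l \<in> trees k \<and> r \<in> trees k"
  by (auto simp: trees_def)

text \<open>The set of values attained up to height \<open>j\<close> grows with \<open>j\<close>
  until it repeats once; by the congruence it is then closed under forming nodes and hence contains
  every value. The number of values therefore bounds the height needed.\<close>

lemma pumping:
  fixes s :: "nat btree \<Rightarrow> 's"
  assumes cong: "\<And>x l r l' r'. x < k \<Longrightarrow> l \<in> trees k \<Longrightarrow> r \<in> trees k \<Longrightarrow> l' \<in> trees k \<Longrightarrow>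
      r' \<in> trees k \<Longrightarrow> s l = s l' \<Longrightarrow> s r = s r' \<Longrightarrow> s (Node x l r) = s (Node x l' r')"
    and fin: "finite (s ` trees k)" and card: "card (s ` trees k) \<le> N"
    and T: "T \<in> trees k"
  shows "\<exists>T'\<in>trees k. s T' = s T \<and> height T' \<le> N"
proof -
  define V where "V j = s ` {T \<in> trees k. height T \<le> j}" for j
  have sub: "V j \<subseteq> s ` trees k" for j by (auto simp: V_def)
  then have finV: "finite (V j)" for j using fin finite_subset by blast
  have mono: "V j \<subseteq> V (Suc j)" for j by (auto simp: V_def)
  have stable: "s T \<in> V j" if st: "V (Suc j) \<subseteq> V j" and "T \<in> trees k" for T j
    using that(2)
  proof (induction T)
    case (Leaf x)
    then show ?case unfolding V_def by (intro imageI) simp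
  next
    case (Node x l r)
    then have m: "x < k" "l \<in> trees k" "r \<in> trees k" and "s l \<in> V j" "s r \<in> V j" by auto
    then obtain l' r' where l': "l' \<in> trees k" "height l' \<le> j" "s l = s l'"
      and r': "r' \<in> trees k" "height r' \<le> j" "s r = s r'"
      unfolding V_def by blast
    then have "s (Node x l' r') \<in> V (Suc j)" using m unfolding V_def by (intro imageI) simp
    then show ?case using st cong[of x l r l' r'] m l' r' by auto
  qed
  \<comment> \<open>Every round that is not yet final adds a value, so the cardinality keeps pace
    with \<open>j\<close>.\<close>
  have "j \<le> card (V j) \<or> V j = s ` trees k" for j
  proof (induction j)
    case (Suc j)
    show ?case
    proof (cases "V (Suc j) \<subseteq> V j")
      case True
      then have "s ` trees k \<subseteq> V (Suc j)" using stable mono by blast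
      then show ?thesis using sub by blast
    next
      case False
      then have "V j \<subset> V (Suc j)" "V j \<noteq> s ` trees k" using mono sub by blast+
      then have "card (V j) < card (V (Suc j))" "j \<le> card (V j)"
        using Suc psubset_card_mono[OF finV] by blast+
      then show ?thesis by linarith
    qed
  qed simp
  then have "V N = s ` trees k" using card sub fin
    by (metis card_seteq le_trans)
  then have "s T \<in> V N" using T by blast
  then show ?thesis unfolding V_def by (metis (mono_tags, lifting) imageE mem_Collect_eq)
qed

section \<open>Downsets, directed sets and node closures\<close>

definition downset :: "'a btree set \<Rightarrow> bool" where
  "downset I \<longleftrightarrow> (\<forall>X\<in>I. \<forall>Y. Y \<preceq> X \<longrightarrow> Y \<in> I)"

text \<open>The empty set counts as directed; it takes the place of the ideals of the two children
  when a spine ends in a leaf.\<close>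

definition directed :: "'a btree set \<Rightarrow> bool" where
  "directed I \<longleftrightarrow> (\<forall>X\<in>I. \<forall>Y\<in>I. \<exists>Z\<in>I. X \<preceq> Z \<and> Y \<preceq> Z)"

lemma downsetD: "downset I \<Longrightarrow> X \<in> I \<Longrightarrow> Y \<preceq> X \<Longrightarrow> Y \<in> I"
  unfolding downset_def by blast

lemma downset_empty: "downset {}" and directed_empty: "directed {}"
  by (auto simp: downset_def directed_def)

lemma contains_Node_mono: "l \<preceq> l' \<Longrightarrow> r \<preceq> r' \<Longrightarrow> Node x l r \<preceq> Node x l' r'"
  by (auto simp: contains_Node_right)

lemma contains_Node_mono_swap: "l \<preceq> r' \<Longrightarrow> r \<preceq> l' \<Longrightarrow> Node x l r \<preceq> Node x l' r'"
  by (auto simp: contains_Node_right)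

lemma contains_Node_left_child: "X \<preceq> l \<Longrightarrow> X \<preceq> Node x l r"
  and contains_Node_right_child: "X \<preceq> r \<Longrightarrow> X \<preceq> Node x l r"
  by (auto simp: contains_Node_right)

text \<open>For nonempty downsets \<open>I\<close> and \<open>J\<close> this is the downset
  generated by the nodes labelled \<open>x\<close> over \<open>I\<close> and \<open>J\<close>; for
  \<open>I = J = {}\<close> it is \<open>{Leaf x}\<close>.\<close>

definition node_closure :: "'a \<Rightarrow> 'a btree set \<Rightarrow> 'a btree set \<Rightarrow> 'a btree set" where
  "node_closure x I J = I \<union> J \<union> {Leaf x} \<union>
     {Node x X Y |X Y. X \<in> I \<and> Y \<in> J \<or> X \<in> J \<and> Y \<in> I}"

lemma downset_node_closure:
  assumes "downset I" "downset J"
  shows "downset (node_closure x I J)"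
  unfolding downset_def
proof (intro ballI allI impI)
  fix X Y assume X: "X \<in> node_closure x I J" and Y: "Y \<preceq> X"
  have sub: "I \<union> J \<union> {Leaf x} \<subseteq> node_closure x I J" by (auto simp: node_closure_def)
  show "Y \<in> node_closure x I J"
  proof (cases "X \<in> I \<union> J \<union> {Leaf x}")
    case True
    then have "Y \<in> I \<union> J \<union> {Leaf x}"
      using Y downsetD[OF assms(1)] downsetD[OF assms(2)] by auto
    with sub show ?thesis by blast
  next
    case False
    then obtain X1 X2 where X: "X = Node x X1 X2" and X12: "X1 \<in> I \<and> X2 \<in> J \<or> X1 \<in> J \<and> X2 \<in> I"
      using X by (auto simp: node_closure_def)
    then have in1: "Y1 \<preceq> X1 \<Longrightarrow> Y2 \<preceq> X2 \<Longrightarrow> Y1 \<in> I \<and> Y2 \<in> J \<or> Y1 \<in> J \<and> Y2 \<in> I" for Y1 Y2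
      using X12 downsetD[OF assms(1)] downsetD[OF assms(2)] by blast
    from Y[unfolded X contains_Node_right]
    consider "Y \<preceq> X1" | "Y \<preceq> X2" | "Y = Leaf x" | Y1 Y2 where "Y = Node x Y1 Y2" "Y1 \<preceq> X1" "Y2 \<preceq> X2"
      | Y1 Y2 where "Y = Node x Y1 Y2" "Y2 \<preceq> X1" "Y1 \<preceq> X2" by blast
    then show ?thesis
    proof cases
      case 4
      then show ?thesis using in1[of Y1 Y2] by (simp add: node_closure_def)
    next
      case 5
      then show ?thesis using in1[of Y2 Y1] by (simp add: node_closure_def) blast
    qed (use in1[of Y X2] in1[of X1 Y] contains_refl sub in blast)+
  qed
qed

text \<open>If both sets are nonempty, each member lies under a node over \<open>I\<close> and
  \<open>J\<close>, and two such nodes are joined child by child. If exactly one were empty, the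
  closure would merely add \<open>Leaf x\<close> to the other, possibly without a common
  bound.\<close>

lemma directed_node_closure:
  assumes I: "directed I" and J: "directed J" and IJ: "I = {} \<longleftrightarrow> J = {}"
  shows "directed (node_closure x I J)"
proof (cases "I = {} \<or> J = {}")
  case True
  with IJ show ?thesis by (auto simp: directed_def node_closure_def)
next
  case False
  have up: "\<exists>A\<in>I. \<exists>B\<in>J. X \<preceq> Node x A B" if "X \<in> node_closure x I J" for X
  proof -
    obtain A0 B0 where "A0 \<in> I" "B0 \<in> J" using False by blast
    then show ?thesis using that unfolding node_closure_def
      by (auto simp: contains_Node_right intro: contains_refl) (use contains_refl in blast)+
  qed
  show ?thesis
    unfolding directed_def
  proof (intro ballI)
    fix X Y assume "X \<in> node_closure x I J" "Y \<in> node_closure x I J"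
    then obtain A B A' B' where *: "A \<in> I" "B \<in> J" "X \<preceq> Node x A B" "A' \<in> I" "B' \<in> J" "Y \<preceq> Node x A' B'"
      using up by meson
    obtain C D where "C \<in> I" "A \<preceq> C" "A' \<preceq> C" "D \<in> J" "B \<preceq> D" "B' \<preceq> D"
      using * I J unfolding directed_def by meson
    moreover from this have "Node x C D \<in> node_closure x I J" by (auto simp: node_closure_def)
    ultimately show "\<exists>Z\<in>node_closure x I J. X \<preceq> Z \<and> Y \<preceq> Z"
      using * by (meson contains_Node_mono contains_trans)
  qed
qed

section \<open>Ideals of a tree automaton\<close>

text \<open>\<open>G\<close> gives the labels allowed at spine vertices with the side trees allowed
  beside them, and \<open>B\<close> the lower ends of spines. The clauses \<open>side\<close> and
  \<open>leaf\<close> add what remains when a spine vertex loses its spine child, so that downward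
  closure is kept.\<close>

inductive_set spine_closure :: "('a \<times> 'a btree set) set \<Rightarrow> 'a btree set \<Rightarrow> 'a btree set"
  for G B where
  base: "X \<in> B \<Longrightarrow> X \<in> spine_closure G B"
| left: "(a, E) \<in> G \<Longrightarrow> S \<in> spine_closure G B \<Longrightarrow> T \<in> E \<Longrightarrow> Node a S T \<in> spine_closure G B"
| right: "(a, E) \<in> G \<Longrightarrow> S \<in> spine_closure G B \<Longrightarrow> T \<in> E \<Longrightarrow> Node a T S \<in> spine_closure G B"
| side: "(a, E) \<in> G \<Longrightarrow> T \<in> E \<Longrightarrow> T \<in> spine_closure G B"
| leaf: "(a, E) \<in> G \<Longrightarrow> Leaf a \<in> spine_closure G B"

lemma downset_spine_closure:
  assumes B: "downset B" and G: "\<And>a E. (a, E) \<in> G \<Longrightarrow> downset E"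
  shows "downset (spine_closure G B)"
proof -
  have "\<forall>Y. Y \<preceq> X \<longrightarrow> Y \<in> spine_closure G B" if "X \<in> spine_closure G B" for X
    using that
  proof induction
    case (base X)
    then show ?case using downsetD[OF B base] spine_closure.base by blast
  next
    case (left a E S T)
    show ?case
    proof (intro allI impI)
      fix Y assume "Y \<preceq> Node a S T"
      then consider "Y \<preceq> S" | "Y \<preceq> T" | "Y = Leaf a"
        | Y1 Y2 where "Y = Node a Y1 Y2" "Y1 \<preceq> S" "Y2 \<preceq> T"
        | Y1 Y2 where "Y = Node a Y1 Y2" "Y2 \<preceq> S" "Y1 \<preceq> T" unfolding contains_Node_right by blast
      then show "Y \<in> spine_closure G B"
      proof cases
        case 1
        then show ?thesis using left by blast
      next
        case 2
        then show ?thesis using downsetD[OF G[OF left(1)] left(3)] spine_closure.side[OF left(1)] by blast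
      next
        case 3
        then show ?thesis using spine_closure.leaf[OF left(1)] by blast
      next
        case 4
        then show ?thesis
          using downsetD[OF G[OF left(1)] left(3)] spine_closure.left[OF left(1)] left(4) by blast
      next
        case 5
        then show ?thesis
          using downsetD[OF G[OF left(1)] left(3)] spine_closure.right[OF left(1)] left(4) by blast
      qed
    qed
  next
    case (right a E S T)
    show ?case
    proof (intro allI impI)
      fix Y assume "Y \<preceq> Node a T S"
      then consider "Y \<preceq> S" | "Y \<preceq> T" | "Y = Leaf a"
        | Y1 Y2 where "Y = Node a Y1 Y2" "Y1 \<preceq> S" "Y2 \<preceq> T"
        | Y1 Y2 where "Y = Node a Y1 Y2" "Y2 \<preceq> S" "Y1 \<preceq> T" unfolding contains_Node_right by blast
      then show "Y \<in> spine_closure G B"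
      proof cases
        case 1
        then show ?thesis using right by blast
      next
        case 2
        then show ?thesis using downsetD[OF G[OF right(1)] right(3)] spine_closure.side[OF right(1)] by blast
      next
        case 3
        then show ?thesis using spine_closure.leaf[OF right(1)] by blast
      next
        case 4
        then show ?thesis
          using downsetD[OF G[OF right(1)] right(3)] spine_closure.left[OF right(1)] right(4) by blast
      next
        case 5
        then show ?thesis
          using downsetD[OF G[OF right(1)] right(3)] spine_closure.right[OF right(1)] right(4) by blast
      qed
    qed
  next
    case (side a E T)
    then show ?case using downsetD[OF G[OF side(1)] side(2)] spine_closure.side[OF side(1)] by blast
  next
    case (leaf a E)
    then show ?case using spine_closure.leaf by auto
  qed
  then show ?thesis unfolding downset_def by blast
qed

text \<open>Spines can be stacked: a further spine vertex may be put above a common bound without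
  losing anything below it. Nonempty side sets supply the side tree needed to extend a
  \<open>leaf\<close> member to a full spine vertex.\<close>

lemma directed_spine_closure:
  assumes B: "directed B" and ne: "\<And>a E. (a, E) \<in> G \<Longrightarrow> E \<noteq> {}"
  shows "directed (spine_closure G B)"
proof -
  let ?C = "spine_closure G B"
  have l: "\<exists>Z\<in>?C. Node a S T \<preceq> Z \<and> Y \<preceq> Z"
    and r: "\<exists>Z\<in>?C. Node a T S \<preceq> Z \<and> Y \<preceq> Z"
    if h: "(a, E) \<in> G" "T \<in> E" "\<exists>Z\<in>?C. S \<preceq> Z \<and> Y \<preceq> Z" for a E S T Y
  proof -
    obtain Z where Z: "Z \<in> ?C" "S \<preceq> Z" "Y \<preceq> Z" using h(3) by blast
    then have "Node a Z T \<in> ?C" using spine_closure.left[OF h(1) _ h(2)] by blast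
    moreover have "Node a S T \<preceq> Node a Z T" "Node a T S \<preceq> Node a Z T"
      using Z by (auto intro: contains_Node_mono contains_Node_mono_swap contains_refl)
    moreover have "Y \<preceq> Node a Z T" using Z by (auto intro: contains_Node_left_child)
    ultimately show "\<exists>Z\<in>?C. Node a S T \<preceq> Z \<and> Y \<preceq> Z" "\<exists>Z\<in>?C. Node a T S \<preceq> Z \<and> Y \<preceq> Z" by blast+
  qed
  have s: "\<exists>Z\<in>?C. T \<preceq> Z \<and> Y \<preceq> Z" and f: "\<exists>Z\<in>?C. Leaf a \<preceq> Z \<and> Y \<preceq> Z"
    if "(a, E) \<in> G" "T \<in> E" "Y \<in> ?C" for a E T Y
  proof -
    have "Node a Y T \<in> ?C" using spine_closure.left[OF that(1) that(3) that(2)] .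
    moreover have "T \<preceq> Node a Y T" "Y \<preceq> Node a Y T" "Leaf a \<preceq> Node a Y T"
      by (auto simp: contains_Node_child contains_Leaf_Node)
    ultimately show "\<exists>Z\<in>?C. T \<preceq> Z \<and> Y \<preceq> Z" "\<exists>Z\<in>?C. Leaf a \<preceq> Z \<and> Y \<preceq> Z" by blast+
  qed
  \<comment> \<open>A bottom tree against an arbitrary member, by induction on the latter; only two
    bottom trees call on the directedness of \<open>B\<close>.\<close>
  have b: "\<exists>Z\<in>?C. Y \<preceq> Z \<and> X \<preceq> Z" if X: "X \<in> B" and Y: "Y \<in> ?C" for X Y
    using Y
  proof induction
    case (base Y)
    then show ?case using B X spine_closure.base unfolding directed_def by meson
  next
    case left then show ?case using l by blast
  next
    case right then show ?case using r by blast
  next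
    case side then show ?case using s X spine_closure.base by blast
  next
    case leaf then show ?case using f X ne spine_closure.base by blast
  qed
  have "\<exists>Z\<in>?C. X \<preceq> Z \<and> Y \<preceq> Z" if X: "X \<in> ?C" and Y: "Y \<in> ?C" for X Y
    using X
  proof induction
    case base then show ?case using b Y by blast
  next
    case left then show ?case using l by blast
  next
    case right then show ?case using r by blast
  next
    case side then show ?case using s Y by blast
  next
    case leaf then show ?case using f Y ne by blast
  qed
  then show ?thesis unfolding directed_def by blast
qed

text \<open>This reduces membership of a node to memberships of its children and to memberships of
  the node in \<open>B\<close> and the side sets, which is what lets an automaton recognise the
  closure.\<close>

lemma Node_in_spine_closure:
  "Node x X1 X2 \<in> spine_closure G B \<longleftrightarrow> Node x X1 X2 \<in> B \<or> (\<exists>a E. (a, E) \<in> G \<and> Node x X1 X2 \<in> E) \<or>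
     (\<exists>E. (x, E) \<in> G \<and> (X1 \<in> spine_closure G B \<and> X2 \<in> E \<or> X1 \<in> E \<and> X2 \<in> spine_closure G B))"
  (is "?L \<longleftrightarrow> ?R")
proof
  show "?L \<Longrightarrow> ?R" by (erule spine_closure.cases) auto
  show "?R \<Longrightarrow> ?L" by (metis spine_closure.base spine_closure.left spine_closure.right spine_closure.side)
qed

text \<open>A recurrence for the number of ideals: \<open>n\<close> sets \<open>below q\<close> and
  the empty set at the start, and in each round one spine closure for every state, label and pair of
  earlier ideals.\<close>

definition ideal_bound :: "nat \<Rightarrow> nat \<Rightarrow> nat \<Rightarrow> nat" where
  "ideal_bound k n h = rec_nat (Suc n) (\<lambda>_ b. b + n * k * (b * b)) h"

text \<open>The common setting for a given automaton and for the one that recognises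
  \<open>Forb\<close>. Only states attained by trees over the \<open>k\<close> labels are
  counted.\<close>

locale tree_fold =
  fixes k n :: nat and leaf_state :: "nat \<Rightarrow> 's" and node_state :: "nat \<Rightarrow> 's \<Rightarrow> 's \<Rightarrow> 's"
    and st :: "nat btree \<Rightarrow> 's"
  defines st_def: "st \<equiv> fold_btree leaf_state node_state"
  assumes fin: "finite (st ` trees k)" and card_le: "card (st ` trees k) \<le> n"
begin

abbreviation Q where "Q \<equiv> st ` trees k"

lemma st_simps [simp]: "st (Leaf x) = leaf_state x" "st (Node x l r) = node_state x (st l) (st r)"
  by (simp_all add: st_def)

lemma node_state_in [intro]: "x < k \<Longrightarrow> p \<in> Q \<Longrightarrow> q \<in> Q \<Longrightarrow> node_state x p q \<in> Q"
  by (clarsimp, metis Node_in_trees image_eqI st_simps(2))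

section \<open>Reachability between states\<close>

definition step :: "('s \<times> 's) set" where
  "step = {(q, q'). q \<in> Q \<and> (\<exists>x<k. \<exists>p\<in>Q. q' = node_state x q p \<or> q' = node_state x p q)}"

abbreviation reach (infix "\<sqsubseteq>" 50) where "p \<sqsubseteq> q \<equiv> (p, q) \<in> step\<^sup>*"

lemma reach_left: "x < k \<Longrightarrow> p \<in> Q \<Longrightarrow> q \<in> Q \<Longrightarrow> p \<sqsubseteq> node_state x p q"
  and reach_right: "x < k \<Longrightarrow> p \<in> Q \<Longrightarrow> q \<in> Q \<Longrightarrow> q \<sqsubseteq> node_state x p q"
  by (rule r_into_rtrancl, auto simp: step_def)+

text \<open>Allowing all states from which \<open>q\<close> is reachable makes monotonicity
  immediate; by \<open>below_attained\<close> the state \<open>q\<close> alone would give the same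
  set.\<close>

definition below :: "'s \<Rightarrow> nat btree set" where
  "below q = {X. \<exists>T\<in>trees k. st T \<sqsubseteq> q \<and> X \<preceq> T}"

lemma belowI: "T \<in> trees k \<Longrightarrow> st T \<sqsubseteq> q \<Longrightarrow> X \<preceq> T \<Longrightarrow> X \<in> below q"
  by (auto simp: below_def)

lemma below_mono: "p \<sqsubseteq> q \<Longrightarrow> below p \<subseteq> below q"
  by (auto simp: below_def intro: rtrancl_trans)

lemma downset_below: "downset (below q)"
  by (auto simp: downset_def below_def intro: contains_trans)

lemma below_nonempty: "q \<in> Q \<Longrightarrow> below q \<noteq> {}"
  by (auto simp: below_def intro: contains_refl)

text \<open>Each step of reachability is realised by placing the tree beside a sibling of the
  required state, and this preserves what the tree contains.\<close>

lemma below_attained: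
  assumes "X \<in> below q" shows "\<exists>T\<in>trees k. st T = q \<and> X \<preceq> T"
proof -
  obtain T where T: "T \<in> trees k" "st T \<sqsubseteq> q" "X \<preceq> T" using assms by (auto simp: below_def)
  from T(2) show ?thesis
  proof induction
    case base
    then show ?case using T by blast
  next
    case (step p q)
    then obtain T where T: "T \<in> trees k" "st T = p" "X \<preceq> T" by blast
    obtain x P where P: "x < k" "P \<in> trees k" "q = node_state x p (st P) \<or> q = node_state x (st P) p"
      using step(2) unfolding step_def by blast
    have "X \<preceq> Node x T P" "X \<preceq> Node x P T"
      using T by (auto intro: contains_Node_left_child contains_Node_right_child)
    moreover have "Node x T P \<in> trees k" "Node x P T \<in> trees k" using T P by auto
    ultimately show ?case using P(3) T(2) st_simps(2) by metis
  qed
qed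

lemma Node_in_belowI:
  assumes "X1 \<in> below p1" "X2 \<in> below p2" "x < k" "node_state x p1 p2 \<sqsubseteq> q"
  shows "Node x X1 X2 \<in> below q" "Node x X2 X1 \<in> below q"
proof -
  obtain T1 T2 where T: "T1 \<in> trees k" "st T1 = p1" "X1 \<preceq> T1" "T2 \<in> trees k" "st T2 = p2" "X2 \<preceq> T2"
    using assms(1,2) below_attained by meson
  have "Node x T1 T2 \<in> trees k" "st (Node x T1 T2) \<sqsubseteq> q" using T assms by auto
  then show "Node x X1 X2 \<in> below q" "Node x X2 X1 \<in> below q"
    using contains_Node_mono[OF T(3,6), of x] contains_Node_mono_swap[OF T(6,3), of x]
    by (blast intro: belowI)+
qed

text \<open>The states \<open>p1\<close> and \<open>p2\<close> are those of the children of the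
  vertex to which the root is sent, found by descending in the containing tree. Only memberships of
  \<open>X1\<close> and \<open>X2\<close> in sets \<open>below p\<close> enter, so these memberships
  are computed bottom-up.\<close>

lemma Node_in_below:
  "Node x X1 X2 \<in> below q \<longleftrightarrow> x < k \<and> (\<exists>p1\<in>Q. \<exists>p2\<in>Q. node_state x p1 p2 \<sqsubseteq> q \<and>
     (X1 \<in> below p1 \<and> X2 \<in> below p2 \<or> X1 \<in> below p2 \<and> X2 \<in> below p1))" (is "?L \<longleftrightarrow> ?R")
proof
  assume ?L
  then obtain T where "T \<in> trees k" "st T \<sqsubseteq> q" "Node x X1 X2 \<preceq> T" by (auto simp: below_def)
  then show ?R
  proof (induction T)
    case (Node y l r)
    then have m: "y < k" "l \<in> trees k" "r \<in> trees k" by auto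
    then have le: "st l \<sqsubseteq> q" "st r \<sqsubseteq> q"
      using Node.prems(2) reach_left[of y "st l" "st r"] reach_right[of y "st l" "st r"]
      by (auto intro: rtrancl_trans)
    from Node.prems(3)[unfolded contains_Node_right]
    consider "Node x X1 X2 \<preceq> l" | "Node x X1 X2 \<preceq> r"
      | "x = y" "X1 \<preceq> l \<and> X2 \<preceq> r \<or> X1 \<preceq> r \<and> X2 \<preceq> l" by auto
    then show ?case
    proof cases
      case 3
      then have "X1 \<in> below (st l) \<and> X2 \<in> below (st r) \<or> X1 \<in> below (st r) \<and> X2 \<in> below (st l)"
        using m by (auto intro: belowI)
      moreover have "node_state y (st l) (st r) \<sqsubseteq> q" using Node.prems(2) by simp
      ultimately show ?thesis using m 3(1) by blast
    qed (use Node.IH m le in blast)+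
  qed simp
next
  assume ?R
  then show ?L using Node_in_belowI by blast
qed

section \<open>Strongly connected components and their loops\<close>

definition equiv_state (infix "\<simeq>" 50) where "p \<simeq> q \<longleftrightarrow> p \<sqsubseteq> q \<and> q \<sqsubseteq> p"

lemma below_equiv: "p \<simeq> q \<Longrightarrow> below p = below q"
  unfolding equiv_state_def using below_mono by blast

text \<open>The spine vertices that stay in the component of \<open>q\<close>. The side trees are
  taken from the whole downset \<open>below p\<close> rather than from the trees of state
  \<open>p\<close>.\<close>

definition loops :: "'s \<Rightarrow> (nat \<times> nat btree set) set" where
  "loops q = {(a, below p) |a p. a < k \<and> p \<in> Q \<and>
     (\<exists>q'\<in>Q. q' \<simeq> q \<and> (node_state a q' p \<simeq> q \<or> node_state a p q' \<simeq> q))}"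

definition branching :: "'s \<Rightarrow> bool" where
  "branching q \<longleftrightarrow> (\<exists>x<k. \<exists>p1\<in>Q. \<exists>p2\<in>Q. p1 \<simeq> q \<and> p2 \<simeq> q \<and> node_state x p1 p2 \<simeq> q)"

text \<open>This keeps an ideal usable while a tree is climbed inside the component: a tree in the
  ideal stays in it under a further spine vertex.\<close>

definition loop_closed :: "'s \<Rightarrow> nat btree set \<Rightarrow> bool" where
  "loop_closed q I \<longleftrightarrow> (\<forall>(a, E)\<in>loops q. \<forall>S\<in>I. \<forall>T\<in>E. Node a S T \<in> I \<and> Node a T S \<in> I)"

lemma loop_closedD:
  assumes "loop_closed q I" "(a, E) \<in> loops q" "S \<in> I" "T \<in> E"
  shows "Node a S T \<in> I" "Node a T S \<in> I"
  using assms unfolding loop_closed_def by blast+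

lemma loop_closed_below: "loop_closed q (below q)"
  unfolding loop_closed_def
proof clarify
  fix a E S T assume "(a, E) \<in> loops q" and S: "S \<in> below q" and T: "T \<in> E"
  then obtain p q' where *: "E = below p" "a < k" "p \<in> Q" "q' \<in> Q" "q' \<simeq> q"
    "node_state a q' p \<simeq> q \<or> node_state a p q' \<simeq> q" unfolding loops_def by blast
  moreover have "S \<in> below q'" using S *(5) below_equiv by blast
  ultimately show "Node a S T \<in> below q \<and> Node a T S \<in> below q"
    using T Node_in_belowI[of S q' T p a q] Node_in_belowI[of T p S q' a q]
    unfolding equiv_state_def by blast
qed

lemma loop_closed_spine_closure: "loop_closed q (spine_closure (loops q) B)"
  unfolding loop_closed_def by (auto intro: spine_closure.left spine_closure.right)

lemma spine_closure_below:
  assumes "B \<subseteq> below q" "q \<in> Q" shows "spine_closure (loops q) B \<subseteq> below q"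
proof
  fix X assume "X \<in> spine_closure (loops q) B"
  then show "X \<in> below q"
  proof induction
    case (base X)
    then show ?case using assms by blast
  next
    case (left a E S T)
    then show ?case using loop_closedD(1)[OF loop_closed_below] by blast
  next
    case (right a E S T)
    then show ?case using loop_closedD(2)[OF loop_closed_below] by blast
  next
    \<comment> \<open>A side tree is contained in a full spine vertex over any tree of
      \<open>below q\<close>; the same vertex serves for its label.\<close>
    case (side a E T)
    obtain S where "S \<in> below q" using below_nonempty assms(2) by blast
    then have "Node a S T \<in> below q" using side loop_closedD[OF loop_closed_below] by blast
    then show ?case by (rule downsetD[OF downset_below]) (rule contains_Node_child(2))
  next
    case (leaf a E)
    then obtain p where "E = below p" "p \<in> Q" unfolding loops_def by blast
    then obtain S T where "S \<in> below q" "T \<in> E" using below_nonempty assms(2) by blast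
    then have "Node a S T \<in> below q" using leaf loop_closedD[OF loop_closed_below] by blast
    then show ?case by (rule downsetD[OF downset_below]) (rule contains_Leaf_Node)
  qed
qed

text \<open>A finite supply of candidates, not all directed. All sets \<open>below p\<close> enter
  at the start because they are the side sets of \<open>loops\<close>, so that membership in them is
  always recorded; \<open>{}\<close> is there for the leaves.\<close>

fun ideals :: "nat \<Rightarrow> nat btree set set" where
  "ideals 0 = insert {} (below ` Q)"
| "ideals (Suc h) = ideals h \<union>
     (\<lambda>(q, x, I, J). spine_closure (loops q) (node_closure x I J)) ` (Q \<times> {..<k} \<times> ideals h \<times> ideals h)"

lemma ideals_mono: "h \<le> h' \<Longrightarrow> ideals h \<subseteq> ideals h'"
  by (induction rule: dec_induct) auto

lemma finite_ideals: "finite (ideals h)"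
  by (induction h) (use fin in auto)

text \<open>Counts the rounds needed to build the ideals for \<open>q\<close>: it is at most
  \<open>n\<close> and strictly smaller for states from which \<open>q\<close> is reachable but not
  conversely.\<close>

definition rank :: "'s \<Rightarrow> nat" where "rank q = card {p \<in> Q. p \<sqsubseteq> q}"

lemma rank_le: "rank q \<le> n"
  unfolding rank_def using card_le card_mono[OF fin, of "{p \<in> Q. p \<sqsubseteq> q}"] by fastforce

lemma rank_less:
  assumes "p \<sqsubseteq> q" "\<not> q \<sqsubseteq> p" "q \<in> Q" shows "rank p < rank q"
  unfolding rank_def
proof (rule psubset_card_mono)
  show "finite {p \<in> Q. p \<sqsubseteq> q}" using fin by simp
  have "q \<in> {p \<in> Q. p \<sqsubseteq> q}" "q \<notin> {r \<in> Q. r \<sqsubseteq> p}" using assms by auto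
  moreover have "{r \<in> Q. r \<sqsubseteq> p} \<subseteq> {p \<in> Q. p \<sqsubseteq> q}" using assms by (auto intro: rtrancl_trans)
  ultimately show "{r \<in> Q. r \<sqsubseteq> p} \<subset> {p \<in> Q. p \<sqsubseteq> q}" by blast
qed

definition good :: "'s \<Rightarrow> nat btree set \<Rightarrow> bool" where
  "good q I \<longleftrightarrow> downset I \<and> directed I \<and> I \<subseteq> below q \<and> loop_closed q I"

text \<open>The branching transition puts any two trees of \<open>below q\<close> under one node
  whose state is again in the component.\<close>

lemma good_below:
  assumes "branching q" shows "good q (below q)"
proof -
  obtain x p1 p2 where *: "x < k" "p1 \<simeq> q" "p2 \<simeq> q" "node_state x p1 p2 \<simeq> q"
    using assms unfolding branching_def by blast
  have "\<exists>Z\<in>below q. X \<preceq> Z \<and> Y \<preceq> Z" if "X \<in> below q" "Y \<in> below q" for X Y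
  proof (intro bexI conjI)
    show "Node x X Y \<in> below q"
      using Node_in_belowI(1)[of X p1 Y p2 x q] that * below_equiv unfolding equiv_state_def by blast
  qed (rule contains_Node_child)+
  then show ?thesis
    unfolding good_def directed_def using downset_below loop_closed_below by blast
qed

text \<open>Nonempty \<open>I\<close> and \<open>J\<close> provide a node over both in
  \<open>below q\<close>, which puts \<open>Leaf x\<close> there too, and they make the node closure
  directed.\<close>

lemma good_spine_closure:
  assumes "good p I" "good p' J" "x < k" "node_state x p p' \<sqsubseteq> q" "q \<in> Q" "I \<noteq> {}" "J \<noteq> {}"
    "p \<in> Q" "p' \<in> Q"
  shows "good q (spine_closure (loops q) (node_closure x I J))"
proof -
  have sub: "I \<subseteq> below p" "J \<subseteq> below p'" using assms unfolding good_def by auto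
  have pq: "p \<sqsubseteq> q" "p' \<sqsubseteq> q"
    using assms reach_left[of x p p'] reach_right[of x p p'] by (auto intro: rtrancl_trans)
  have N: "Node x X Y \<in> below q" "Node x Y X \<in> below q" if "X \<in> I" "Y \<in> J" for X Y
    using that sub Node_in_belowI[of X p Y p' x q] assms by auto
  obtain X Y where "X \<in> I" "Y \<in> J" using assms by blast
  then have "Node x X Y \<in> below q" using N by blast
  then have "Leaf x \<in> below q" by (rule downsetD[OF downset_below]) (rule contains_Leaf_Node)
  then have "node_closure x I J \<subseteq> below q"
    using N sub below_mono[OF pq(1)] below_mono[OF pq(2)] by (auto simp: node_closure_def)
  moreover have "downset E" "E \<noteq> {}" if "(a, E) \<in> loops q" for a E
    using that downset_below below_nonempty unfolding loops_def by blast+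
  ultimately show ?thesis
    using assms unfolding good_def
    by (intro conjI downset_spine_closure directed_spine_closure downset_node_closure
        directed_node_closure spine_closure_below loop_closed_spine_closure) auto
qed

lemma good_spine_closure_leaf:
  assumes "x < k" "leaf_state x \<sqsubseteq> q" "q \<in> Q"
  shows "good q (spine_closure (loops q) (node_closure x {} {}))"
proof -
  have "node_closure x {} {} \<subseteq> below q"
    using assms by (auto simp: node_closure_def intro!: belowI[of "Leaf x"])
  moreover have "downset E" "E \<noteq> {}" if "(a, E) \<in> loops q" for a E
    using that downset_below below_nonempty unfolding loops_def by blast+
  ultimately show ?thesis
    using assms unfolding good_def
    by (intro conjI downset_spine_closure directed_spine_closure downset_node_closure downset_empty
        directed_empty directed_node_closure spine_closure_below loop_closed_spine_closure) auto
qed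

text \<open>In the nonbranching case, descend while some child stays in the component of
  \<open>q\<close>; loop closure carries the ideal back up. Where both children leave the component,
  their ideals come from earlier rounds and the spine closure over their node closure contains the
  tree.\<close>

lemma good_ideal_exists:
  assumes "T \<in> trees k" "st T \<simeq> q" "q \<in> Q"
  shows "\<exists>I\<in>ideals (rank q). T \<in> I \<and> good q I"
proof (cases "branching q")
  case True
  have "below q \<in> ideals (rank q)" using ideals_mono[of 0 "rank q"] assms(3) by auto
  moreover have "T \<in> below q"
    using assms by (auto simp: equiv_state_def intro: belowI contains_refl)
  ultimately show ?thesis using good_below[OF True] by blast
next
  case False
  show ?thesis
    using assms False
  proof (induction T arbitrary: q)
    case (Leaf x)
    \<comment> \<open>The rank counts \<open>q\<close> itself, so at least one round is
      available.\<close>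
    have "rank q > 0" unfolding rank_def using Leaf(3) fin by (auto simp: card_gt_0_iff)
    then obtain h where h: "rank q = Suc h" by (metis gr0_conv_Suc)
    have "{} \<in> ideals h" using ideals_mono[of 0 h] by auto
    then have "spine_closure (loops q) (node_closure x {} {}) \<in> ideals (rank q)"
      using Leaf unfolding h ideals.simps by (intro UnI2 image_eqI[of _ _ "(q, x, {}, {})"]) auto
    moreover have "Leaf x \<in> spine_closure (loops q) (node_closure x {} {})"
      by (auto simp: node_closure_def intro: spine_closure.base)
    ultimately show ?case
      using good_spine_closure_leaf[of x q] Leaf by (auto simp: equiv_state_def)
  next
    case (Node x l r)
    then have m: "x < k" "l \<in> trees k" "r \<in> trees k" by auto
    have eq: "node_state x (st l) (st r) \<simeq> q" using Node.prems(2) by simp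
    then have le: "st l \<sqsubseteq> q" "st r \<sqsubseteq> q"
      using m reach_left[of x "st l" "st r"] reach_right[of x "st l" "st r"]
      by (auto simp: equiv_state_def intro: rtrancl_trans)
    have in_below: "l \<in> below (st l)" "r \<in> below (st r)" using m by (auto intro: belowI contains_refl)
    show ?case
    proof (cases "q \<sqsubseteq> st l \<or> q \<sqsubseteq> st r")
      case True
      then show ?thesis
      proof
        assume "q \<sqsubseteq> st l"
        then have e: "st l \<simeq> q" using le by (simp add: equiv_state_def)
        then obtain I where I: "I \<in> ideals (rank q)" "l \<in> I" "good q I" using Node m by blast
        have "(x, below (st r)) \<in> loops q" using m e eq unfolding loops_def by blast
        then have "Node x l r \<in> I" using I in_below loop_closedD unfolding good_def by blast
        then show ?thesis using I by blast
      next
        assume "q \<sqsubseteq> st r"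
        then have e: "st r \<simeq> q" using le by (simp add: equiv_state_def)
        then obtain I where I: "I \<in> ideals (rank q)" "r \<in> I" "good q I" using Node m by blast
        have "(x, below (st l)) \<in> loops q" using m e eq unfolding loops_def by blast
        then have "Node x l r \<in> I" using I in_below loop_closedD unfolding good_def by blast
        then show ?thesis using I by blast
      qed
    next
      case False
      \<comment> \<open>The induction hypothesis leaves out branching components; there the whole
        set \<open>below (st T)\<close> is the ideal.\<close>
      have ex: "\<exists>I\<in>ideals (rank (st T)). T \<in> I \<and> good (st T) I"
        if "T \<in> {l, r}" for T
      proof (cases "branching (st T)")
        case True
        have "below (st T) \<in> ideals (rank (st T))"
          using ideals_mono[of 0 "rank (st T)"] that m by auto
        then show ?thesis using good_below[OF True] in_below that by blast
      next
        case False
        have "st T \<simeq> st T" by (simp add: equiv_state_def)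
        then show ?thesis using Node.IH that m False by blast
      qed
      obtain I where I: "I \<in> ideals (rank (st l))" "l \<in> I" "good (st l) I" using ex by blast
      obtain J where J: "J \<in> ideals (rank (st r))" "r \<in> J" "good (st r) J" using ex by blast
      \<comment> \<open>Leaving the component lowers the rank, so both ideals are present one round
        before that of \<open>q\<close>.\<close>
      have lt: "rank (st l) < rank q" "rank (st r) < rank q"
        using rank_less le False Node.prems(3) by blast+
      then obtain h where h: "rank q = Suc h" by (metis less_imp_Suc_add)
      have "I \<in> ideals h" "J \<in> ideals h"
        using I(1) J(1) lt h ideals_mono[of "rank (st l)" h] ideals_mono[of "rank (st r)" h] by auto
      then have "spine_closure (loops q) (node_closure x I J) \<in> ideals (rank q)"
        using m Node.prems(3) unfolding h ideals.simps
        by (intro UnI2 image_eqI[of _ _ "(q, x, I, J)"]) auto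
      moreover have "Node x l r \<in> spine_closure (loops q) (node_closure x I J)"
        using I J by (auto simp: node_closure_def intro: spine_closure.base)
      moreover have "good q (spine_closure (loops q) (node_closure x I J))"
        using I J m eq Node.prems(3)
        by (intro good_spine_closure[of "st l" I "st r" J]) (auto simp: equiv_state_def)
      ultimately show ?thesis by blast
    qed
  qed
qed

section \<open>Recognisability of the ideals\<close>

definition agree :: "nat btree set set \<Rightarrow> nat btree \<Rightarrow> nat btree \<Rightarrow> bool" where
  "agree \<I> X Y \<longleftrightarrow> (\<forall>I\<in>\<I>. X \<in> I \<longleftrightarrow> Y \<in> I)"

text \<open>The set of ideals containing a tree can serve as the state of a bottom-up automaton.
  Agreement of the children is at the fixed level \<open>h\<close>, while the level \<open>m\<close>
  of the tested ideal is lowered by induction.\<close>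

lemma ideals_compositional:
  assumes "m \<le> h" "I \<in> ideals m" "agree (ideals h) X1 Y1" "agree (ideals h) X2 Y2"
  shows "Node x X1 X2 \<in> I \<longleftrightarrow> Node x Y1 Y2 \<in> I"
  using assms(1,2)
proof (induction m arbitrary: I)
  case 0
  have same: "X1 \<in> below p \<longleftrightarrow> Y1 \<in> below p" "X2 \<in> below p \<longleftrightarrow> Y2 \<in> below p" if "p \<in> Q" for p
  proof -
    have "below p \<in> ideals h" using that ideals_mono[of 0 h] by auto
    then show "X1 \<in> below p \<longleftrightarrow> Y1 \<in> below p" "X2 \<in> below p \<longleftrightarrow> Y2 \<in> below p"
      using assms(3,4) unfolding agree_def by blast+
  qed
  have "Node x X1 X2 \<in> below q \<longleftrightarrow> Node x Y1 Y2 \<in> below q" for q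
    unfolding Node_in_below by (intro conj_cong[OF refl] bex_cong[OF refl]) (simp only: same)
  then show ?case using 0 by auto
next
  case (Suc m)
  show ?case
  proof (cases "I \<in> ideals m")
    case True
    then show ?thesis using Suc by simp
  next
    case False
    then obtain q x0 A B where I: "I = spine_closure (loops q) (node_closure x0 A B)"
      and AB: "A \<in> ideals m" "B \<in> ideals m" using Suc.prems(2) by auto
    have same: "X1 \<in> J \<longleftrightarrow> Y1 \<in> J" "X2 \<in> J \<longleftrightarrow> Y2 \<in> J" if "J \<in> ideals (Suc m)" for J
    proof -
      have "J \<in> ideals h" using that ideals_mono[OF Suc.prems(1)] by blast
      then show "X1 \<in> J \<longleftrightarrow> Y1 \<in> J" "X2 \<in> J \<longleftrightarrow> Y2 \<in> J"
        using assms(3,4) unfolding agree_def by blast+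
    qed
    \<comment> \<open>The side sets are of the form \<open>below p\<close> and hence present from
      the start.\<close>
    have sameE: "E \<in> ideals m" if "(a, E) \<in> loops q" for a E
      using that ideals_mono[of 0 m] unfolding loops_def by auto
    have IH: "Node x X1 X2 \<in> J \<longleftrightarrow> Node x Y1 Y2 \<in> J" if "J \<in> ideals m" for J
      using Suc.IH[of J] Suc.prems(1) that by simp
    have B: "Node x X1 X2 \<in> node_closure x0 A B \<longleftrightarrow> Node x Y1 Y2 \<in> node_closure x0 A B"
      using IH[OF AB(1)] IH[OF AB(2)] same[of A] same[of B] AB by (auto simp: node_closure_def)
    have loopE: "(\<exists>a E. (a, E) \<in> loops q \<and> Node x X1 X2 \<in> E) \<longleftrightarrow>
        (\<exists>a E. (a, E) \<in> loops q \<and> Node x Y1 Y2 \<in> E)"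
      using IH sameE by blast
    have "X1 \<in> E \<longleftrightarrow> Y1 \<in> E" "X2 \<in> E \<longleftrightarrow> Y2 \<in> E" if "(a, E) \<in> loops q" for a E
      using same[of E] sameE[OF that] by auto
    then have "(\<exists>E. (x, E) \<in> loops q \<and> (X1 \<in> I \<and> X2 \<in> E \<or> X1 \<in> E \<and> X2 \<in> I)) \<longleftrightarrow>
        (\<exists>E. (x, E) \<in> loops q \<and> (Y1 \<in> I \<and> Y2 \<in> E \<or> Y1 \<in> E \<and> Y2 \<in> I))"
      using same[OF Suc.prems(2)] by blast
    then show ?thesis using B loopE unfolding I Node_in_spine_closure[of x X1 X2] Node_in_spine_closure[of x Y1 Y2] by simp
  qed
qed

section \<open>Reduction to trees of bounded height\<close>

text \<open>Forwards, finitely many trees of \<open>L\<close> are joined one after another.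
  Backwards, \<open>Y\<close> lies in a directed downset \<open>I\<close> within
  \<open>below (st Y)\<close>. A tree of \<open>L\<close> outside \<open>I\<close> would have a
  small counterpart outside \<open>I\<close>, yet that one is contained in \<open>Y\<close>. So
  \<open>L\<close> lies in \<open>I\<close>, and a bound in \<open>I\<close> extends to a tree with
  the accepted state of \<open>Y\<close>.\<close>

lemma JEP_iff_small:
  assumes L: "L = {T \<in> trees k. st T \<in> F}"
    and small: "{T \<in> trees k. height T \<le> n * 2 ^ card (ideals n)} \<subseteq> Small" "finite Small"
  shows "joint_embedding_property (\<preceq>) L \<longleftrightarrow> (\<exists>Y. \<forall>X\<in>Small. X \<in> L \<longrightarrow> Y \<in> L \<and> X \<preceq> Y)"
proof
  assume J: "joint_embedding_property (\<preceq>) L"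
  have "A \<subseteq> L \<Longrightarrow> A \<noteq> {} \<Longrightarrow> \<exists>Y\<in>L. \<forall>X\<in>A. X \<preceq> Y" if "finite A" for A
    using that
  proof (induction A rule: finite_induct)
    case (insert X A)
    show ?case
    proof (cases "A = {}")
      case True
      then show ?thesis using insert.prems contains_refl by auto
    next
      case False
      then obtain Y where Y: "Y \<in> L" "\<forall>X\<in>A. X \<preceq> Y" using insert by auto
      moreover obtain Z where "Z \<in> L" "X \<preceq> Z" "Y \<preceq> Z"
        using J Y(1) insert.prems(1) unfolding joint_embedding_property_def by blast
      ultimately show ?thesis using contains_trans by (metis insert_iff)
    qed
  qed simp
  from this[of "Small \<inter> L"] small(2) show "\<exists>Y. \<forall>X\<in>Small. X \<in> L \<longrightarrow> Y \<in> L \<and> X \<preceq> Y" by auto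
next
  assume "\<exists>Y. \<forall>X\<in>Small. X \<in> L \<longrightarrow> Y \<in> L \<and> X \<preceq> Y"
  then obtain Y where Y: "\<And>X. X \<in> Small \<Longrightarrow> X \<in> L \<Longrightarrow> Y \<in> L \<and> X \<preceq> Y" by blast
  \<comment> \<open>By \<open>ideals_compositional\<close> these data of a node depend only on those
    of its children, so pumping preserves membership in \<open>L\<close> and in every ideal.\<close>
  define s where "s T = (st T, {I \<in> ideals n. T \<in> I})" for T
  have pump: "\<exists>T'\<in>Small. T' \<in> trees k \<and> s T' = s T" if "T \<in> trees k" for T
  proof -
    have sub: "s ` trees k \<subseteq> Q \<times> Pow (ideals n)" by (auto simp: s_def)
    have fin': "finite (Q \<times> Pow (ideals n))" using fin finite_ideals by simp
    have "card (s ` trees k) \<le> card Q * 2 ^ card (ideals n)"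
      using card_mono[OF fin' sub] finite_ideals by (simp add: card_cartesian_product card_Pow)
    then have c: "card (s ` trees k) \<le> n * 2 ^ card (ideals n)"
      using card_le by (meson le_trans mult_le_mono1)
    have "s (Node x l r) = s (Node x l' r')" if "s l = s l'" "s r = s r'" for x l r l' r'
    proof -
      have "agree (ideals n) l l'" "agree (ideals n) r r'"
        using that unfolding s_def agree_def by auto
      then have "Node x l r \<in> I \<longleftrightarrow> Node x l' r' \<in> I" if "I \<in> ideals n" for I
        using ideals_compositional[OF order_refl that] by blast
      then show ?thesis using that unfolding s_def by auto
    qed
    then obtain T' where "T' \<in> trees k" "s T' = s T" "height T' \<le> n * 2 ^ card (ideals n)"
      using pumping[of k s "n * 2 ^ card (ideals n)" T] c \<open>T \<in> trees k\<close> finite_subset[OF sub fin'] by blast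
    then show ?thesis using small(1) by blast
  qed
  show "joint_embedding_property (\<preceq>) L"
  proof (cases "L = {}")
    case True
    then show ?thesis by (simp add: joint_embedding_property_def)
  next
    case False
    then obtain T where "T \<in> trees k" "st T \<in> F" unfolding L by blast
    \<comment> \<open>A nonempty \<open>L\<close> has a small member, which forces \<open>Y\<close>
      into \<open>L\<close>.\<close>
    then obtain T' where "T' \<in> Small" "T' \<in> L" using pump[of T] unfolding L s_def by auto
    then have "Y \<in> L" using Y by blast
    then have Yt: "Y \<in> trees k" "st Y \<in> F" unfolding L by auto
    have "st Y \<simeq> st Y" by (simp add: equiv_state_def)
    then obtain I where I: "I \<in> ideals n" "Y \<in> I" "good (st Y) I"
      using good_ideal_exists[of Y "st Y"] Yt ideals_mono[OF rank_le[of "st Y"]] by blast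
    have sub: "L \<subseteq> I"
    proof
      fix T assume T: "T \<in> L"
      then obtain T' where T': "T' \<in> Small" "T' \<in> trees k" "s T' = s T" using pump L by blast
      then have "T' \<in> L" "T' \<in> I \<longleftrightarrow> T \<in> I" using T I(1) unfolding L s_def by auto
      moreover have "T' \<in> I"
        using Y T'(1) \<open>T' \<in> L\<close> I(2,3) downsetD unfolding good_def by blast
      ultimately show "T \<in> I" by simp
    qed
    show ?thesis
      unfolding joint_embedding_property_def
    proof (intro ballI)
      fix X1 X2 assume "X1 \<in> L" "X2 \<in> L"
      then obtain Z where Z: "Z \<in> I" "X1 \<preceq> Z" "X2 \<preceq> Z"
        using sub I(3) unfolding good_def directed_def by blast
      then have "Z \<in> below (st Y)" using I(3) unfolding good_def by blast
      then obtain T where "T \<in> trees k" "st T = st Y" "Z \<preceq> T" using below_attained by blast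
      moreover from this have "X1 \<preceq> T" "X2 \<preceq> T" using Z contains_trans by blast+
      ultimately show "\<exists>Y\<in>L. X1 \<preceq> Y \<and> X2 \<preceq> Y" using Yt(2) unfolding L by auto
    qed
  qed
qed

text \<open>Of \<open>Y\<close> only its state and the small trees it contains matter. As
  \<open>Small\<close> is closed under children, this pair is computed bottom-up, and pumping
  replaces \<open>Y\<close> by a bounded tree.\<close>

lemma JEP_iff_bounded:
  assumes L: "L = {T \<in> trees k. st T \<in> F}" and k: "k > 0"
    and small: "{T \<in> trees k. height T \<le> n * 2 ^ card (ideals n)} \<subseteq> Small" "finite Small"
    and closed: "\<And>x l r. Node x l r \<in> Small \<Longrightarrow> l \<in> Small \<and> r \<in> Small"
    and large: "{T \<in> trees k. height T \<le> n * 2 ^ card Small} \<subseteq> Large"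
  shows "joint_embedding_property (\<preceq>) L \<longleftrightarrow> (\<exists>Y\<in>Large. \<forall>X\<in>Small. X \<in> L \<longrightarrow> Y \<in> L \<and> X \<preceq> Y)"
proof -
  define s where "s T = (st T, {X \<in> Small. X \<preceq> T})" for T
  have "\<exists>T'\<in>Large. T' \<in> trees k \<and> s T' = s T" if "T \<in> trees k" for T
  proof -
    have sub: "s ` trees k \<subseteq> Q \<times> Pow Small" by (auto simp: s_def)
    have fin': "finite (Q \<times> Pow Small)" using fin small(2) by simp
    have "card (s ` trees k) \<le> card Q * 2 ^ card Small"
      using card_mono[OF fin' sub] small(2) by (simp add: card_cartesian_product card_Pow)
    then have c: "card (s ` trees k) \<le> n * 2 ^ card Small"
      using card_le by (meson le_trans mult_le_mono1)
    have "s (Node x l r) = s (Node x l' r')" if "s l = s l'" "s r = s r'" for x l r l' r'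
    proof -
      have "X \<preceq> l \<longleftrightarrow> X \<preceq> l'" "X \<preceq> r \<longleftrightarrow> X \<preceq> r'" if "X \<in> Small" for X
        using \<open>s l = s l'\<close> \<open>s r = s r'\<close> that unfolding s_def by auto
      then have "X \<preceq> Node x l r \<longleftrightarrow> X \<preceq> Node x l' r'" if "X \<in> Small" for X
        using that closed unfolding contains_Node_right by metis
      then show ?thesis using that unfolding s_def by auto
    qed
    then obtain T' where "T' \<in> trees k" "s T' = s T" "height T' \<le> n * 2 ^ card Small"
      using pumping[of k s "n * 2 ^ card Small" T] c \<open>T \<in> trees k\<close> finite_subset[OF sub fin'] by blast
    then show ?thesis using large by blast
  qed
  moreover have "Leaf 0 \<in> trees k" using k by simp
  ultimately have "(\<exists>Y. \<forall>X\<in>Small. X \<in> L \<longrightarrow> Y \<in> L \<and> X \<preceq> Y) \<longleftrightarrow>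
      (\<exists>Y\<in>Large. \<forall>X\<in>Small. X \<in> L \<longrightarrow> Y \<in> L \<and> X \<preceq> Y)"
    (is "?l \<longleftrightarrow> ?r")
  proof (intro iffI)
    assume pump: "\<And>T. T \<in> trees k \<Longrightarrow> \<exists>T'\<in>Large. T' \<in> trees k \<and> s T' = s T" and leaf: "Leaf 0 \<in> trees k"
    assume ?l
    then obtain Y where Y: "\<And>X. X \<in> Small \<Longrightarrow> X \<in> L \<Longrightarrow> Y \<in> L \<and> X \<preceq> Y" by blast
    show ?r
    proof (cases "Small \<inter> L = {}")
      \<comment> \<open>The condition is vacuous, so any member of \<open>Large\<close> will
        do.\<close>
      case True
      then show ?thesis using pump[OF leaf] by blast
    next
      case False
      then have "Y \<in> trees k" using Y L by blast
      then obtain Y' where "Y' \<in> Large" "Y' \<in> trees k" "s Y' = s Y" using pump by blast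
      then show ?thesis using Y unfolding L s_def by (intro bexI[of _ Y']) auto
    qed
  qed blast
  then show ?thesis using JEP_iff_small[OF L small] by simp
qed

lemma card_ideals: "card (ideals h) \<le> ideal_bound k n h"
proof (induction h)
  case 0
  have "card (insert {} (below ` Q)) \<le> Suc (card (below ` Q))"
    using fin by (simp add: card_insert_if)
  also have "card (below ` Q) \<le> n" using card_image_le[OF fin, of below] card_le by simp
  finally show ?case by (simp add: ideal_bound_def)
next
  case (Suc h)
  have "card (ideals (Suc h)) \<le> card (ideals h) + card (Q \<times> {..<k} \<times> ideals h \<times> ideals h)"
    unfolding ideals.simps using fin finite_ideals
    by (intro order_trans[OF card_Un_le] add_left_mono card_image_le) auto
  also have "\<dots> \<le> ideal_bound k n h + n * (k * (ideal_bound k n h * ideal_bound k n h))"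
    using Suc card_le by (simp add: card_cartesian_product add_mono mult_le_mono)
  finally show ?case by (simp add: ideal_bound_def algebra_simps)
qed

end

section \<open>Computable functions\<close>

text \<open>\<open>recursive_fn\<close> depends on values at lists of other lengths; this version is
  invariant under agreement on lists of length \<open>n\<close>.\<close>

definition computable :: "nat \<Rightarrow> (nat list \<Rightarrow> nat) \<Rightarrow> bool" where
  "computable n F \<longleftrightarrow> (\<exists>f. recursive_fn n f \<and> (\<forall>xs. length xs = n \<longrightarrow> f xs = F xs))"

definition decides :: "nat \<Rightarrow> (nat list \<Rightarrow> bool) \<Rightarrow> bool" where
  "decides n P \<longleftrightarrow> computable n (\<lambda>xs. of_bool (P xs))"

named_theorems comp_intro

lemma computable_cong:
  assumes "computable n F" "\<And>xs. length xs = n \<Longrightarrow> F xs = G xs" shows "computable n G"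
  using assms unfolding computable_def by metis

lemma computable_comp:
  assumes F: "computable (length Gs) F" and Gs: "\<And>G. G \<in> set Gs \<Longrightarrow> computable n G"
  shows "computable n (\<lambda>xs. F (map (\<lambda>G. G xs) Gs))"
proof -
  obtain f where f: "recursive_fn (length Gs) f" "\<And>xs. length xs = length Gs \<Longrightarrow> f xs = F xs"
    using F unfolding computable_def by blast
  obtain w where w: "\<And>G. G \<in> set Gs \<Longrightarrow> recursive_fn n (w G)"
    "\<And>G xs. G \<in> set Gs \<Longrightarrow> length xs = n \<Longrightarrow> w G xs = G xs"
    using Gs unfolding computable_def by metis
  have "recursive_fn n (\<lambda>xs. f (map (\<lambda>g. g xs) (map w Gs)))"
    by (rule recursive_fn.comp) (use f(1) w(1) in auto)
  moreover have "f (map (\<lambda>g. g xs) (map w Gs)) = F (map (\<lambda>G. G xs) Gs)" if "length xs = n" for xs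
  proof -
    have "map (\<lambda>g. g xs) (map w Gs) = map (\<lambda>G. G xs) Gs" using w(2) that by simp
    then show ?thesis using f(2)[of "map (\<lambda>G. G xs) Gs"] by (simp only: length_map)
  qed
  ultimately show ?thesis unfolding computable_def by blast
qed

lemma computable_zero: "computable n (\<lambda>_. 0)"
  unfolding computable_def using recursive_fn.zero by blast

lemma computable_Suc0: "computable 1 (\<lambda>xs. Suc (xs ! 0))"
  unfolding computable_def using recursive_fn.succ by blast

lemma computable_nth [comp_intro]: "i < n \<Longrightarrow> computable n (\<lambda>xs. xs ! i)"
  unfolding computable_def using recursive_fn.proj by blast

text \<open>Under a binder the bound variables stand at the front of the argument list and the
  parameters are reached through \<open>drop\<close>; this rule and the next resolve such
  accesses.\<close>

lemma computable_drop_nth [comp_intro]: "m + i < n \<Longrightarrow> computable n (\<lambda>xs. drop m xs ! i)"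
  by (rule computable_cong[OF computable_nth[of "m + i"]]) (simp_all add: less_diff_conv nth_drop)

lemma computable_drop_drop [comp_intro]:
  "computable n (\<lambda>xs. drop (l + m) (X xs) ! i) \<Longrightarrow> computable n (\<lambda>xs. drop l (drop m (X xs)) ! i)"
  by (simp add: add.commute)

lemma computable_comp1:
  assumes "computable 1 (\<lambda>ys. F (ys ! 0))" "computable n G"
  shows "computable n (\<lambda>xs. F (G xs))"
  using computable_comp[of "[G]" "\<lambda>ys. F (ys ! 0)" n] assms by simp

lemma computable_comp2:
  assumes "computable 2 (\<lambda>ys. F (ys ! 0) (ys ! 1))" "computable n G" "computable n H"
  shows "computable n (\<lambda>xs. F (G xs) (H xs))"
  using computable_comp[of "[G, H]" "\<lambda>ys. F (ys ! 0) (ys ! 1)" n] assms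
  by (auto simp: numeral_2_eq_2)

lemma computable_comp4:
  assumes "computable 4 (\<lambda>ys. F (ys ! 0) (ys ! 1) (ys ! 2) (ys ! 3))"
    "computable n G" "computable n H" "computable n I" "computable n J"
  shows "computable n (\<lambda>xs. F (G xs) (H xs) (I xs) (J xs))"
  using computable_comp[of "[G, H, I, J]" "\<lambda>ys. F (ys ! 0) (ys ! 1) (ys ! 2) (ys ! 3)" n] assms
  by (auto simp: numeral_eq_Suc)

lemma computable_Suc [comp_intro]: "computable n F \<Longrightarrow> computable n (\<lambda>xs. Suc (F xs))"
  by (rule computable_comp1[OF computable_Suc0])

lemma computable_const [comp_intro]: "computable n (\<lambda>_. c)"
  by (induction c) (auto intro: computable_zero computable_Suc)

text \<open>In the step function, argument \<open>0\<close> is the counter, argument \<open>1\<close> the previous value, and the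
  remaining arguments are the parameters.\<close>

lemma computable_rec_nat [comp_intro]:
  assumes N: "computable n N" and A: "computable n A"
    and B: "computable (Suc (Suc n)) (\<lambda>ys. B (ys ! 0) (ys ! 1) (drop 2 ys))"
  shows "computable n (\<lambda>xs. rec_nat (A xs) (\<lambda>i r. B i r xs) (N xs))"
proof -
  obtain a where a: "recursive_fn n a" "\<And>xs. length xs = n \<Longrightarrow> a xs = A xs"
    using A unfolding computable_def by blast
  obtain b where b: "recursive_fn (Suc (Suc n)) b"
    "\<And>xs. length xs = Suc (Suc n) \<Longrightarrow> b xs = B (xs ! 0) (xs ! 1) (drop 2 xs)"
    using B unfolding computable_def by blast
  have "recursive_fn (Suc n) (\<lambda>xs. rec_nat (a (tl xs)) (\<lambda>i r. b (i # r # tl xs)) (hd xs))"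
    by (rule recursive_fn.prim_rec[OF a(1) b(1)])
  then have "computable (Suc n) (\<lambda>xs. rec_nat (a (tl xs)) (\<lambda>i r. b (i # r # tl xs)) (hd xs))"
    unfolding computable_def by blast
  then have *: "computable (length (N # map (\<lambda>i xs. xs ! i) [0..<n]))
      (\<lambda>xs. rec_nat (a (tl xs)) (\<lambda>i r. b (i # r # tl xs)) (hd xs))" by simp
  show ?thesis
  proof (rule computable_cong[OF computable_comp[OF *]])
    fix xs :: "nat list" assume len: "length xs = n"
    have "map (\<lambda>G. G xs) (map (\<lambda>i xs. xs ! i) [0..<n]) = xs"
      using map_nth[of xs] len by (simp add: comp_def)
    moreover have "b (i # r # xs) = B i r xs" for i r using b(2) len by simp
    ultimately show "rec_nat (a (tl (map (\<lambda>G. G xs) (N # map (\<lambda>i xs. xs ! i) [0..<n]))))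
        (\<lambda>i r. b (i # r # tl (map (\<lambda>G. G xs) (N # map (\<lambda>i xs. xs ! i) [0..<n]))))
        (hd (map (\<lambda>G. G xs) (N # map (\<lambda>i xs. xs ! i) [0..<n]))) = rec_nat (A xs) (\<lambda>i r. B i r xs) (N xs)"
      using a(2) len by simp
  qed (use N computable_nth in auto)
qed

lemma computable_Least:
  assumes P: "decides (Suc n) (\<lambda>ys. P (ys ! 0) (drop 1 ys))"
    and ex: "\<And>xs. length xs = n \<Longrightarrow> \<exists>y. P y xs"
  shows "computable n (\<lambda>xs. LEAST y. P y xs)"
proof -
  \<comment> \<open>Minimisation looks for a zero, so the truth value is negated by a recursion of
    length at most one.\<close>
  have "computable (Suc n) (\<lambda>ys. rec_nat 1 (\<lambda>i r. 0) (of_bool (P (ys ! 0) (drop 1 ys))))"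
    by (intro computable_rec_nat computable_const P[unfolded decides_def])
  then obtain f where f: "recursive_fn (Suc n) f"
    "\<And>xs. length xs = Suc n \<Longrightarrow> f xs = rec_nat 1 (\<lambda>i r. 0) (of_bool (P (xs ! 0) (drop 1 xs)) :: nat)"
    unfolding computable_def by blast
  have z: "f (y # xs) = 0 \<longleftrightarrow> P y xs" if "length xs = n" for y xs
    using f(2)[of "y # xs"] that by simp
  have "recursive_fn n (\<lambda>xs. LEAST y. f (y # xs) = 0)"
    by (rule recursive_fn.minim[OF f(1)]) (use z ex in auto)
  moreover have "(LEAST y. f (y # xs) = 0) = (LEAST y. P y xs)" if "length xs = n" for xs
    using z that by simp
  ultimately show ?thesis unfolding computable_def by blast
qed

section \<open>Arithmetic\<close>

lemma computable_add [comp_intro]: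
  assumes "computable n F" "computable n G" shows "computable n (\<lambda>xs. F xs + G xs)"
proof -
  have "computable n (\<lambda>xs. rec_nat (F xs) (\<lambda>i r. Suc r) (G xs))"
    by (intro assms comp_intro) simp
  moreover have "rec_nat a (\<lambda>i r. Suc r) b = a + b" for a b :: nat by (induction b) auto
  ultimately show ?thesis by simp
qed

lemma computable_mult [comp_intro]:
  assumes "computable n F" "computable n G" shows "computable n (\<lambda>xs. F xs * G xs)"
proof -
  have "computable 2 (\<lambda>xs. rec_nat 0 (\<lambda>i r. r + xs ! 0) (xs ! 1))"
    by (intro comp_intro) simp_all
  moreover have "rec_nat 0 (\<lambda>i r. r + a) b = a * b" for a b :: nat by (induction b) auto
  ultimately show ?thesis using computable_comp2[of "(*)", OF _ assms] by simp
qed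

lemma computable_power [comp_intro]:
  assumes "computable n F" "computable n G" shows "computable n (\<lambda>xs. F xs ^ G xs)"
proof -
  have "computable 2 (\<lambda>xs. rec_nat 1 (\<lambda>i r. xs ! 0 * r) (xs ! 1))"
    by (intro comp_intro) simp_all
  moreover have "rec_nat 1 (\<lambda>i r. a * r) b = a ^ b" for a b :: nat by (induction b) auto
  ultimately show ?thesis using computable_comp2[of "(^)", OF _ assms] by simp
qed

lemma computable_diff [comp_intro]:
  assumes "computable n F" "computable n G" shows "computable n (\<lambda>xs. F xs - G xs)"
proof -
  \<comment> \<open>A recursion that returns its counter gives the predecessor, with value 0 at
    0.\<close>
  have "computable 1 (\<lambda>xs. rec_nat 0 (\<lambda>i r. i) (xs ! 0))"
    by (intro comp_intro) simp_all
  moreover have "rec_nat 0 (\<lambda>i r. i) a = a - 1" for a :: nat by (cases a) auto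
  ultimately have "computable 1 (\<lambda>xs. xs ! 0 - 1)" by simp
  then have pred: "computable n (\<lambda>xs. F xs - 1)" if "computable n F" for n F
    using computable_comp1[of "\<lambda>x. x - 1", OF _ that] by simp
  have "computable n (\<lambda>xs. rec_nat (F xs) (\<lambda>i r. r - 1) (G xs))"
    by (intro assms computable_rec_nat pred computable_nth) simp_all
  moreover have "rec_nat a (\<lambda>i r. r - 1) b = a - b" for a b :: nat by (induction b) auto
  ultimately show ?thesis by simp
qed

lemma computable_of_bool [comp_intro]: "decides n P \<Longrightarrow> computable n (\<lambda>xs. of_bool (P xs))"
  by (simp add: decides_def)

lemma computable_if [comp_intro]:
  assumes "decides n P" "computable n F" "computable n G"
  shows "computable n (\<lambda>xs. if P xs then F xs else G xs)"
proof -
  have "computable n (\<lambda>xs. of_bool (P xs) * F xs + (1 - of_bool (P xs)) * G xs)"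
    by (intro assms comp_intro)
  then show ?thesis by (rule computable_cong) simp
qed

section \<open>Decidable predicates\<close>

lemma decides_const [comp_intro]: "decides n (\<lambda>_. b)"
  unfolding decides_def by (rule computable_const)

lemma decides_not [comp_intro]:
  assumes "decides n P" shows "decides n (\<lambda>xs. \<not> P xs)"
proof -
  have "computable n (\<lambda>xs. 1 - of_bool (P xs))" by (intro assms comp_intro)
  then show ?thesis unfolding decides_def by (rule computable_cong) simp
qed

lemma decides_conj [comp_intro]:
  assumes "decides n P" "decides n R" shows "decides n (\<lambda>xs. P xs \<and> R xs)"
proof -
  have "computable n (\<lambda>xs. of_bool (P xs) * of_bool (R xs))" by (intro assms comp_intro)
  then show ?thesis unfolding decides_def by (rule computable_cong) simp
qed

lemma decides_disj [comp_intro]: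
  assumes "decides n P" "decides n R" shows "decides n (\<lambda>xs. P xs \<or> R xs)"
proof -
  have "decides n (\<lambda>xs. \<not> (\<not> P xs \<and> \<not> R xs))" by (intro assms comp_intro)
  then show ?thesis by simp
qed

lemma decides_imp [comp_intro]:
  assumes "decides n P" "decides n R" shows "decides n (\<lambda>xs. P xs \<longrightarrow> R xs)"
proof -
  have "decides n (\<lambda>xs. \<not> P xs \<or> R xs)" by (intro assms comp_intro)
  then show ?thesis by simp
qed

lemma decides_le [comp_intro]:
  assumes "computable n F" "computable n G" shows "decides n (\<lambda>xs. F xs \<le> G xs)"
proof -
  have "computable n (\<lambda>xs. 1 - (F xs - G xs))" by (intro assms comp_intro)
  then show ?thesis unfolding decides_def by (rule computable_cong) auto
qed

lemma decides_less [comp_intro]: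
  assumes "computable n F" "computable n G" shows "decides n (\<lambda>xs. F xs < G xs)"
proof -
  have "decides n (\<lambda>xs. Suc (F xs) \<le> G xs)" by (intro assms comp_intro)
  then show ?thesis by (simp add: Suc_le_eq)
qed

lemma decides_eq [comp_intro]:
  assumes "computable n F" "computable n G" shows "decides n (\<lambda>xs. F xs = G xs)"
proof -
  have "decides n (\<lambda>xs. F xs \<le> G xs \<and> G xs \<le> F xs)" by (intro assms comp_intro)
  then show ?thesis by (simp add: order_eq_iff)
qed

text \<open>Moves a body from one binder depth to another: the leading arguments are replaced, and
  the parameters after the first \<open>d\<close> entries are passed on.\<close>

lemma computable_subst_drop:
  assumes F: "computable (length Gs + n) F" and Gs: "\<And>G. G \<in> set Gs \<Longrightarrow> computable m G"
    and m: "m = d + n"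
  shows "computable m (\<lambda>xs. F (map (\<lambda>G. G xs) Gs @ drop d xs))"
proof -
  let ?Hs = "Gs @ map (\<lambda>i xs. drop d xs ! i) [0..<n]"
  have "computable m (\<lambda>xs. F (map (\<lambda>G. G xs) ?Hs))"
    using F Gs m by (intro computable_comp) (auto intro!: computable_drop_nth)
  then show ?thesis
  proof (rule computable_cong)
    fix xs :: "nat list" assume "length xs = m"
    then have "map (\<lambda>i. drop d xs ! i) [0..<n] = drop d xs"
      using map_nth[of "drop d xs"] m by simp
    then show "F (map (\<lambda>G. G xs) ?Hs) = F (map (\<lambda>G. G xs) Gs @ drop d xs)"
      by (simp add: comp_def)
  qed
qed

lemma computable_subst1:
  assumes F: "computable (Suc n) (\<lambda>ys. F (ys ! 0) (drop 1 ys))" and G: "computable m G"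
    and m: "m = d + n"
  shows "computable m (\<lambda>xs. F (G xs) (drop d xs))"
proof -
  have "computable m (\<lambda>xs. (\<lambda>ys. F (ys ! 0) (drop 1 ys)) (map (\<lambda>G. G xs) [G] @ drop d xs))"
    by (rule computable_subst_drop[OF _ _ m]) (use F G in auto)
  then show ?thesis by simp
qed

lemma computable_subst2:
  assumes F: "computable (Suc (Suc n)) (\<lambda>ys. F (ys ! 0) (ys ! 1) (drop 2 ys))"
    and G: "computable m G" and H: "computable m H" and m: "m = d + n"
  shows "computable m (\<lambda>xs. F (G xs) (H xs) (drop d xs))"
proof -
  have "computable m (\<lambda>xs. (\<lambda>ys. F (ys ! 0) (ys ! 1) (drop 2 ys)) (map (\<lambda>G. G xs) [G, H] @ drop d xs))"
    by (rule computable_subst_drop[OF _ _ m]) (use F G H in auto)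
  then show ?thesis by simp
qed

lemma decides_bex [comp_intro]:
  assumes N: "computable n N" and P: "decides (Suc n) (\<lambda>ys. P (ys ! 0) (drop 1 ys))"
  shows "decides n (\<lambda>xs. \<exists>i<N xs. P i xs)"
proof -
  \<comment> \<open>The recursion also carries an accumulator, which the predicate has to
    skip.\<close>
  have "computable (Suc (Suc n)) (\<lambda>ys. of_bool (P (ys ! 0) (drop 2 ys)))"
    by (rule computable_subst1[OF P[unfolded decides_def]]) (simp_all add: computable_nth)
  then have "computable n (\<lambda>xs. rec_nat 0 (\<lambda>i r. if P i xs then 1 else r) (N xs))"
    by (intro N comp_intro) (simp_all add: decides_def)
  moreover have "rec_nat (0 :: nat) (\<lambda>i r. if Q i then 1 else r) m = of_bool (\<exists>i<m. Q i)" for Q m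
    by (induction m) (auto simp: less_Suc_eq)
  ultimately show ?thesis by (simp add: decides_def)
qed

lemma decides_ball [comp_intro]:
  assumes "computable n N" "decides (Suc n) (\<lambda>ys. P (ys ! 0) (drop 1 ys))"
  shows "decides n (\<lambda>xs. \<forall>i<N xs. P i xs)"
proof -
  have "decides n (\<lambda>xs. \<not> (\<exists>i<N xs. \<not> P i xs))" by (intro assms comp_intro)
  then show ?thesis by simp
qed

lemma computable_div [comp_intro]:
  assumes "computable n F" "computable n G" shows "computable n (\<lambda>xs. F xs div G xs)"
proof -
  \<comment> \<open>The first disjunct makes the search total and yields 0 for divisor 0, as
    \<open>div\<close> does.\<close>
  have "computable 2 (\<lambda>xs. LEAST q. xs ! 1 = 0 \<or> xs ! 0 < Suc q * xs ! 1)"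
  proof (rule computable_Least)
    show "decides (Suc 2) (\<lambda>ys. drop 1 ys ! 1 = 0 \<or> drop 1 ys ! 0 < Suc (ys ! 0) * drop 1 ys ! 1)"
      by (intro comp_intro) simp_all
    show "\<exists>q. xs ! 1 = 0 \<or> xs ! 0 < Suc q * xs ! 1" for xs :: "nat list"
      by (rule exI[of _ "xs ! 0"]) (cases "xs ! 1", auto)
  qed
  moreover have "(LEAST q. b = 0 \<or> a < Suc q * b) = a div b" for a b :: nat
  proof (cases "b = 0")
    case False
    then show ?thesis
      by (intro Least_equality) (auto simp: dividend_less_div_times less_mult_imp_div_less less_Suc_eq_le[symmetric])
  qed simp
  ultimately show ?thesis using computable_comp2[of "(div)", OF _ assms] by simp
qed

lemma decides_dvd2 [comp_intro]:
  assumes "computable n F" shows "decides n (\<lambda>xs. even (F xs))"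
proof -
  have "decides n (\<lambda>xs. 2 * (F xs div 2) = F xs)" by (intro assms comp_intro)
  moreover have "2 * (m div 2) = m \<longleftrightarrow> even m" for m :: nat
    by (metis dvd_mult_div_cancel dvd_triv_left)
  ultimately show ?thesis by simp
qed

section \<open>Coded pairs\<close>

lemma computable_prod_encode [comp_intro]:
  assumes "computable n F" "computable n G" shows "computable n (\<lambda>xs. prod_encode (F xs, G xs))"
proof -
  have "computable n (\<lambda>xs. (F xs + G xs) * Suc (F xs + G xs) div 2 + F xs)"
    by (intro assms comp_intro)
  then show ?thesis by (simp add: prod_encode_def triangle_def)
qed

lemma computable_fst_decode [comp_intro]:
  assumes "computable n F" shows "computable n (\<lambda>xs. fst (prod_decode (F xs)))"
proof -
  \<comment> \<open>A component never exceeds the code of its pair, so the other component is sought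
    below a bound.\<close>
  have eq: "(\<exists>b<Suc p. prod_encode (a, b) = p) \<longleftrightarrow> a = fst (prod_decode p)" for a p
    by (metis fst_conv le_imp_less_Suc le_prod_encode_2 prod.collapse prod_decode_inverse prod_encode_inverse)
  have "computable 1 (\<lambda>xs. LEAST a. \<exists>b<Suc (xs ! 0). prod_encode (a, b) = xs ! 0)"
  proof (rule computable_Least)
    show "decides (Suc 1) (\<lambda>ys. \<exists>b<Suc (drop 1 ys ! 0). prod_encode (ys ! 0, b) = drop 1 ys ! 0)"
      by (intro comp_intro) simp_all
  qed (simp add: eq)
  then have "computable 1 (\<lambda>xs. fst (prod_decode (xs ! 0)))" by (simp add: eq Least_equality)
  then show ?thesis using computable_comp1[of "\<lambda>p. fst (prod_decode p)"] assms by blast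
qed

lemma computable_snd_decode [comp_intro]:
  assumes "computable n F" shows "computable n (\<lambda>xs. snd (prod_decode (F xs)))"
proof -
  have eq: "(\<exists>a<Suc p. prod_encode (a, b) = p) \<longleftrightarrow> b = snd (prod_decode p)" for b p
    by (metis snd_conv le_imp_less_Suc le_prod_encode_1 prod.collapse prod_decode_inverse prod_encode_inverse)
  have "computable 1 (\<lambda>xs. LEAST b. \<exists>a<Suc (xs ! 0). prod_encode (a, b) = xs ! 0)"
  proof (rule computable_Least)
    show "decides (Suc 1) (\<lambda>ys. \<exists>a<Suc (drop 1 ys ! 0). prod_encode (a, ys ! 0) = drop 1 ys ! 0)"
      by (intro comp_intro) simp_all
  qed (simp add: eq)
  then have "computable 1 (\<lambda>xs. snd (prod_decode (xs ! 0)))" by (simp add: eq Least_equality)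
  then show ?thesis using computable_comp1[of "\<lambda>p. snd (prod_decode p)"] assms by blast
qed

section \<open>Computing on codes of trees\<close>

text \<open>A nonempty list is coded by the successor of the pair of its head and the code of its
  tail; the subtractions of 1 remove that successor.\<close>

definition nth_code :: "nat \<Rightarrow> nat \<Rightarrow> nat" where
  "nth_code c i = fst (prod_decode (rec_nat c (\<lambda>_ r. snd (prod_decode (r - 1))) i - 1))"

lemma nth_code_list_encode: "i < length ys \<Longrightarrow> nth_code (list_encode ys) i = ys ! i"
proof -
  have "i \<le> length ys \<Longrightarrow>
      rec_nat (list_encode ys) (\<lambda>_ r. snd (prod_decode (r - 1))) i = list_encode (drop i ys)"
  proof (induction i)
    case (Suc i)
    then show ?case using Cons_nth_drop_Suc[of i ys] by (metis Suc_le_lessD diff_Suc_1 less_imp_le_nat list_encode.simps(2) old.nat.simps(7) prod_encode_inverse snd_conv)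
  qed simp
  then show "i < length ys \<Longrightarrow> nth_code (list_encode ys) i = ys ! i"
    using Cons_nth_drop_Suc[of i ys, symmetric] by (simp add: nth_code_def)
qed

lemma computable_nth_code [comp_intro]:
  assumes "computable n F" "computable n G" shows "computable n (\<lambda>xs. nth_code (F xs) (G xs))"
  unfolding nth_code_def by (intro assms comp_intro) simp

text \<open>The first argument of \<open>B\<close> is the code of the list of earlier values, latest first.\<close>

lemma computable_course_of_values:
  assumes B: "computable (Suc (Suc n)) (\<lambda>ys. B (ys ! 0) (ys ! 1) (drop 2 ys))"
    and f: "\<And>p xs. length xs = n \<Longrightarrow> f p xs = B (list_encode (map (\<lambda>i. f i xs) (rev [0..<p]))) p xs"
  shows "computable (Suc n) (\<lambda>ys. f (ys ! 0) (drop 1 ys))"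
proof -
  define hist where "hist p xs = rec_nat 0 (\<lambda>i r. Suc (prod_encode (B r i xs, r))) p" for p xs
  have hist: "hist p xs = list_encode (map (\<lambda>i. f i xs) (rev [0..<p]))" if "length xs = n" for p xs
  proof (induction p)
    case (Suc p)
    then show ?case using f[OF that, of p] by (simp add: hist_def)
  qed (simp add: hist_def)
  have "computable (Suc (Suc (Suc n))) (\<lambda>ys. B (ys ! 1) (ys ! 0) (drop 3 ys))"
    by (rule computable_subst2[OF B]) (simp_all add: computable_nth)
  then have "computable (Suc n) (\<lambda>ys. hist (ys ! 0) (drop 1 ys))"
    unfolding hist_def by (intro comp_intro) (simp_all add: numeral_3_eq_3)
  then have "computable (Suc n) (\<lambda>ys. B (hist (ys ! 0) (drop 1 ys)) (ys ! 0) (drop 1 ys))"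
    by (rule computable_subst2[OF B]) (simp_all add: computable_nth)
  then show ?thesis by (rule computable_cong) (simp add: hist f[symmetric])
qed

text \<open>Halving drops the low bit of a code, which is 0 for leaves and 1 for nodes.\<close>

definition code_label :: "nat \<Rightarrow> nat" where "code_label t = fst (prod_decode (t div 2))"
definition code_left :: "nat \<Rightarrow> nat" where
  "code_left t = fst (prod_decode (snd (prod_decode (t div 2))))"
definition code_right :: "nat \<Rightarrow> nat" where
  "code_right t = snd (prod_decode (snd (prod_decode (t div 2))))"

lemma computable_code_parts [comp_intro]:
  assumes "computable n F"
  shows "computable n (\<lambda>xs. code_label (F xs))" "computable n (\<lambda>xs. code_left (F xs))"
    "computable n (\<lambda>xs. code_right (F xs))"
  unfolding code_label_def code_left_def code_right_def by (intro assms comp_intro)+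

lemma code_parts_less: assumes "odd t" shows "code_left t < t" "code_right t < t"
proof -
  have "snd (prod_decode m) \<le> m" "fst (prod_decode m) \<le> m" for m
    by (metis le_prod_encode_1 le_prod_encode_2 prod.collapse prod_decode_inverse)+
  then have "code_left t \<le> t div 2" "code_right t \<le> t div 2"
    unfolding code_left_def code_right_def by (meson le_trans)+
  moreover have "t div 2 < t" using assms by (cases t) auto
  ultimately show "code_left t < t" "code_right t < t" by auto
qed

text \<open>Every number is thus the code of a tree, and quantifiers over numbers become quantifiers
  over trees without a check for validity.\<close>

lemma surj_tree_encode: "\<exists>T. tree_encode T = t"
proof (induction t rule: less_induct)
  case (less t)
  show ?case
  proof (cases "even t")
    case True
    then show ?thesis by (intro exI[of _ "Leaf (t div 2)"]) simp
  next
    case False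
    then obtain l r where "tree_encode l = code_left t" "tree_encode r = code_right t"
      using less code_parts_less by meson
    then have "tree_encode (Node (code_label t) l r) = t"
      using False by (simp add: code_label_def code_left_def code_right_def)
    then show ?thesis by blast
  qed
qed

definition tree_decode :: "nat \<Rightarrow> nat btree" where
  "tree_decode = inv tree_encode"

lemma tree_decode_inverse [simp]: "tree_encode (tree_decode t) = t"
  unfolding tree_decode_def using surj_tree_encode by (metis f_inv_into_f rangeI)

lemma tree_encode_inverse [simp]: "tree_decode (tree_encode T) = T"
  unfolding tree_decode_def using inj_tree_encode by simp

lemma tree_decode_even: "even t \<Longrightarrow> tree_decode t = Leaf (t div 2)"
  by (metis dvd_mult_div_cancel tree_encode.simps(1) tree_encode_inverse)

lemma tree_decode_odd:
  assumes "odd t"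
  shows "tree_decode t = Node (code_label t) (tree_decode (code_left t)) (tree_decode (code_right t))"
proof -
  have "tree_encode (Node (code_label t) (tree_decode (code_left t)) (tree_decode (code_right t))) = t"
    using assms by (simp add: code_label_def code_left_def code_right_def)
  then show ?thesis by (metis tree_encode_inverse)
qed

text \<open>Children have smaller codes, so the fold is a course-of-values recursion on the code.
  The parameter \<open>S\<close> lets the transitions depend on the encoded instance.\<close>

lemma computable_fold_btree:
  assumes g0: "computable 2 (\<lambda>xs. g0 (xs ! 0) (xs ! 1))"
    and g2: "computable 4 (\<lambda>xs. g2 (xs ! 0) (xs ! 1) (xs ! 2) (xs ! 3))"
    and S: "computable n S" and T: "computable n T"
  shows "computable n (\<lambda>xs. fold_btree (g0 (S xs)) (g2 (S xs)) (tree_decode (T xs)))"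
proof -
  define B where "B h p xs = (if even p then g0 (xs ! 0) (p div 2) else
    g2 (xs ! 0) (code_label p) (nth_code h (p - Suc (code_left p))) (nth_code h (p - Suc (code_right p))))"
    for h p and xs :: "nat list"
  define f where "f p xs = fold_btree (g0 (xs ! 0)) (g2 (xs ! 0)) (tree_decode p)" for p and xs :: "nat list"
  have "computable (Suc 1) (\<lambda>ys. f (ys ! 0) (drop 1 ys))"
  proof (rule computable_course_of_values)
    show "computable (Suc (Suc 1)) (\<lambda>ys. B (ys ! 0) (ys ! 1) (drop 2 ys))"
      unfolding B_def by (intro comp_intro computable_comp2[OF g0] computable_comp4[OF g2]) simp_all
    fix p and xs :: "nat list"
    let ?h = "list_encode (map (\<lambda>i. f i xs) (rev [0..<p]))"
    \<comment> \<open>The history holds the latest value first, so the value at \<open>i\<close>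
      stands at position \<open>p - Suc i\<close>.\<close>
    have h: "nth_code ?h (p - Suc i) = f i xs" if "i < p" for i
      using that by (subst nth_code_list_encode) (auto simp: rev_nth)
    show "f p xs = B ?h p xs"
    proof (cases "even p")
      case True
      then show ?thesis by (simp add: f_def B_def tree_decode_even)
    next
      case False
      then show ?thesis using h[OF code_parts_less(1)] h[OF code_parts_less(2)]
        by (simp add: f_def[of p] B_def tree_decode_odd) (simp add: f_def)
    qed
  qed
  then have "computable 2 (\<lambda>ys. fold_btree (g0 (ys ! 1)) (g2 (ys ! 1)) (tree_decode (ys ! 0)))"
    unfolding Suc_1 by (rule computable_cong) (simp add: f_def)
  from computable_comp2[OF this T S] show ?thesis .
qed

section \<open>Coded sets and containment\<close>

definition mem_code :: "nat \<Rightarrow> nat \<Rightarrow> bool" where "mem_code u c \<longleftrightarrow> u \<in> set_decode c"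

lemma decides_mem_code [comp_intro]:
  assumes "computable n F" "computable n G" shows "decides n (\<lambda>xs. mem_code (F xs) (G xs))"
  unfolding mem_code_def set_decode_def mem_Collect_eq by (intro assms comp_intro)

lemma mem_set_encode [simp]: "finite A \<Longrightarrow> mem_code u (set_encode A) \<longleftrightarrow> u \<in> A"
  by (simp add: mem_code_def set_encode_inverse)

lemma computable_set_encode [comp_intro]:
  assumes "computable n N" "decides (Suc (Suc n)) (\<lambda>ys. P (ys ! 0) (drop 2 ys))"
  shows "computable n (\<lambda>xs. set_encode {u. u < N xs \<and> P u xs})"
proof -
  have "computable n (\<lambda>xs. rec_nat 0 (\<lambda>u r. if P u xs then r + 2 ^ u else r) (N xs))"
    by (intro assms comp_intro) simp_all
  moreover have "rec_nat 0 (\<lambda>u r. if P u then r + 2 ^ u else r) s = set_encode {u. u < s \<and> P u}"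
    for P and s :: nat
  proof (induction s)
    case (Suc s)
    have "{u. u < Suc s \<and> P u} = (if P s then insert s {u. u < s \<and> P u} else {u. u < s \<and> P u})"
      by (auto simp: less_Suc_eq)
    then show ?case using Suc by (simp add: set_encode_def)
  qed (simp add: set_encode_def)
  ultimately show ?thesis by simp
qed

text \<open>With \<open>contained_node\<close>, the transitions of an automaton whose state codes
  the set of trees with code below \<open>s\<close> that the input contains. They copy
  \<open>contains_Node_right\<close>, with \<open>2 * x\<close> as the code of
  \<open>Leaf x\<close>.\<close>

definition contained_leaf :: "nat \<Rightarrow> nat \<Rightarrow> nat" where
  "contained_leaf s x = set_encode {u. u < s \<and> u = 2 * x}"

definition contained_node :: "nat \<Rightarrow> nat \<Rightarrow> nat \<Rightarrow> nat \<Rightarrow> nat" where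
  "contained_node s x y z = set_encode {u. u < s \<and> (mem_code u y \<or> mem_code u z \<or> u = 2 * x \<or>
     odd u \<and> code_label u = x \<and>
       (mem_code (code_left u) y \<and> mem_code (code_right u) z \<or>
        mem_code (code_left u) z \<and> mem_code (code_right u) y))}"

lemma fold_contained:
  "fold_btree (contained_leaf s) (contained_node s) T = set_encode {u. u < s \<and> tree_decode u \<preceq> T}"
proof (induction T)
  case (Leaf x)
  have "tree_decode u = Leaf x \<longleftrightarrow> u = 2 * x" for u
    by (metis tree_decode_inverse tree_encode.simps(1) tree_encode_inverse)
  then show ?case by (simp add: contained_leaf_def)
next
  case (Node x l r)
  have char: "tree_decode u \<preceq> Node x l r \<longleftrightarrow> tree_decode u \<preceq> l \<or> tree_decode u \<preceq> r \<or> u = 2 * x \<or>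
     odd u \<and> code_label u = x \<and>
       (tree_decode (code_left u) \<preceq> l \<and> tree_decode (code_right u) \<preceq> r \<or>
        tree_decode (code_left u) \<preceq> r \<and> tree_decode (code_right u) \<preceq> l)" for u
    unfolding contains_Node_right
    by (cases "even u") (auto simp: tree_decode_even tree_decode_odd elim!: evenE)
  let ?c = "\<lambda>T. set_encode {u. u < s \<and> tree_decode u \<preceq> T}"
  have mem: "mem_code u (?c T) \<longleftrightarrow> tree_decode u \<preceq> T" if "u < s" for u T using that by simp
  have "tree_decode u \<preceq> Node x l r \<longleftrightarrow> mem_code u (?c l) \<or> mem_code u (?c r) \<or> u = 2 * x \<or>
     odd u \<and> code_label u = x \<and>
       (mem_code (code_left u) (?c l) \<and> mem_code (code_right u) (?c r) \<or>
        mem_code (code_left u) (?c r) \<and> mem_code (code_right u) (?c l))" if u: "u < s" for u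
  proof (cases "even u")
    case True
    then show ?thesis unfolding char mem[OF u] by simp
  next
    case False
    \<comment> \<open>The children of \<open>u\<close> have smaller codes, so the states record them
      as well.\<close>
    then have "code_left u < s" "code_right u < s"
      using u code_parts_less by (meson less_trans)+
    then show ?thesis unfolding char mem[OF u] by (simp only: mem)
  qed
  then have "{u. u < s \<and> tree_decode u \<preceq> Node x l r} = {u. u < s \<and>
      (mem_code u (?c l) \<or> mem_code u (?c r) \<or> u = 2 * x \<or> odd u \<and> code_label u = x \<and>
       (mem_code (code_left u) (?c l) \<and> mem_code (code_right u) (?c r) \<or>
        mem_code (code_left u) (?c r) \<and> mem_code (code_right u) (?c l)))}"
    by (intro Collect_cong conj_cong refl)
  then show ?case using Node by (simp only: fold_btree.simps contained_node_def)
qed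

lemma computable_contained:
  shows computable_contained_leaf: "computable 2 (\<lambda>xs. contained_leaf (xs ! 0) (xs ! 1))"
    and computable_contained_node: "computable 4 (\<lambda>xs. contained_node (xs ! 0) (xs ! 1) (xs ! 2) (xs ! 3))"
  unfolding contained_leaf_def contained_node_def by (intro comp_intro; simp)+

lemma decides_contains [comp_intro]:
  assumes "computable n F" "computable n G"
  shows "decides n (\<lambda>xs. tree_decode (F xs) \<preceq> tree_decode (G xs))"
proof -
  \<comment> \<open>The bound \<open>Suc (F xs)\<close> is just large enough for the state to record
    the code \<open>F xs\<close>.\<close>
  have "decides n (\<lambda>xs. mem_code (F xs)
      (fold_btree (contained_leaf (Suc (F xs))) (contained_node (Suc (F xs))) (tree_decode (G xs))))"
    by (intro assms comp_intro computable_fold_btree computable_contained)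
  then show ?thesis unfolding fold_contained by simp
qed

lemma decides_labels [comp_intro]:
  assumes "computable n T" shows "decides n (\<lambda>xs. tree_decode (T xs) \<in> trees k)"
proof -
  define g0 where "g0 s x = (if x < k then 1 else 0 :: nat)" for s x :: nat
  define g2 where "g2 s x y z = (if x < k then y * z else 0 :: nat)" for s x y z :: nat
  have "fold_btree (g0 s) (g2 s) T = of_bool (T \<in> trees k)" for s T
    by (induction T) (auto simp: g0_def g2_def)
  moreover have "computable n (\<lambda>xs. fold_btree (g0 0) (g2 0) (tree_decode (T xs)))"
    by (rule computable_fold_btree[of g0 g2 n "\<lambda>_. 0"]; (unfold g0_def g2_def)?; intro assms comp_intro; simp)
  ultimately show ?thesis unfolding decides_def by simp
qed

section \<open>Decidability\<close>

text \<open>As pairing is monotone, labels up to \<open>k\<close> and children with codes up to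
  \<open>c\<close> give a node whose code is at most the value of the step.\<close>

definition code_bound :: "nat \<Rightarrow> nat \<Rightarrow> nat" where
  "code_bound k h = rec_nat (2 * k) (\<lambda>_ c. Suc (2 * prod_encode (k, prod_encode (c, c)))) h"

lemma prod_encode_mono: "a \<le> a' \<Longrightarrow> b \<le> b' \<Longrightarrow> prod_encode (a, b) \<le> prod_encode (a', b')"
  unfolding prod_encode_def triangle_def
  by (auto intro!: add_mono div_le_mono mult_le_mono)

lemma code_bound_Suc: "code_bound k (Suc h) = Suc (2 * prod_encode (k, prod_encode (code_bound k h, code_bound k h)))"
  by (simp add: code_bound_def)

lemma tree_encode_le_bound: "T \<in> trees k \<Longrightarrow> height T \<le> h \<Longrightarrow> tree_encode T \<le> code_bound k h"
proof (induction T arbitrary: h)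
  case (Leaf x)
  have "2 * k \<le> code_bound k h"
  proof (induction h)
    case (Suc h)
    have "code_bound k h \<le> prod_encode (k, prod_encode (code_bound k h, code_bound k h))"
      using le_prod_encode_2 by (meson le_trans)
    with Suc show ?case by (simp add: code_bound_Suc)
  qed (simp add: code_bound_def)
  with Leaf show ?case by simp
next
  case (Node x l r)
  then obtain h' where h: "h = Suc h'" by (cases h) auto
  with Node have "tree_encode l \<le> code_bound k h'" "tree_encode r \<le> code_bound k h'" "x \<le> k" by auto
  then show ?case unfolding h code_bound_Suc by (simp add: prod_encode_mono)
qed

text \<open>Initial segments of codes contain all trees of bounded height and are closed under
  children, so they can serve as \<open>Small\<close> and \<open>Large\<close>; their size is at
  most the bound on the codes plus one.\<close>

lemma (in tree_fold) JEP_iff_codes: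
  assumes L: "L = {T \<in> trees k. st T \<in> F}" and k: "k > 0"
    and c: "c = code_bound k (n * 2 ^ ideal_bound k n n)"
  shows "joint_embedding_property (\<preceq>) L \<longleftrightarrow> (\<exists>y<Suc (code_bound k (n * 2 ^ Suc c)). \<forall>x<Suc c.
    tree_decode x \<in> L \<longrightarrow> tree_decode y \<in> L \<and> tree_decode x \<preceq> tree_decode y)"
proof -
  define Codes where "Codes c = tree_decode ` {..<Suc c}" for c
  have mem: "T \<in> Codes c \<longleftrightarrow> tree_encode T \<le> c" for T c
    unfolding Codes_def by (metis imageE imageI lessThan_iff less_Suc_eq_le tree_decode_inverse tree_encode_inverse)
  have height: "{T \<in> trees k. height T \<le> h} \<subseteq> Codes (code_bound k h')" if "h \<le> h'" for h h'
    using that tree_encode_le_bound unfolding mem subset_iff by auto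
  have fin: "finite (Codes c)" and card: "card (Codes c) \<le> Suc c" for c
    unfolding Codes_def using card_image_le[of "{..<Suc c}" tree_decode] by auto
  have closed: "l \<in> Codes c \<and> r \<in> Codes c" if "Node x l r \<in> Codes c" for x l r c
  proof -
    let ?t = "tree_encode (Node x l r)"
    have "code_left ?t = tree_encode l" "code_right ?t = tree_encode r"
      by (simp_all add: code_left_def code_right_def)
    then have "tree_encode l < ?t" "tree_encode r < ?t" using code_parts_less[of ?t] by simp_all
    moreover have "?t \<le> c" using that unfolding mem .
    ultimately show ?thesis unfolding mem by linarith
  qed
  have "joint_embedding_property (\<preceq>) L \<longleftrightarrow> (\<exists>Y\<in>Codes (code_bound k (n * 2 ^ Suc c)).
      \<forall>X\<in>Codes c. X \<in> L \<longrightarrow> Y \<in> L \<and> X \<preceq> Y)"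
  proof (rule JEP_iff_bounded[OF L k _ fin closed])
    show "{T \<in> trees k. height T \<le> n * 2 ^ card (ideals n)} \<subseteq> Codes c"
      unfolding c by (intro height mult_le_mono2 power_increasing card_ideals) simp
    show "{T \<in> trees k. height T \<le> n * 2 ^ card (Codes c)} \<subseteq> Codes (code_bound k (n * 2 ^ Suc c))"
      by (intro height mult_le_mono2 power_increasing card) simp
  qed
  then show ?thesis unfolding Codes_def by (simp only: bex_simps ball_simps Bex_def lessThan_iff) auto
qed

text \<open>Serves both kinds of instance: the transitions and the acceptance test read the encoded
  instance, and \<open>N\<close> bounds the number of states computably.\<close>

lemma decidable_JEP:
  fixes g0 :: "nat \<Rightarrow> nat \<Rightarrow> nat" and g2 :: "nat \<Rightarrow> nat \<Rightarrow> nat \<Rightarrow> nat \<Rightarrow> nat"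
  assumes k: "k > 0"
    and g0: "computable 2 (\<lambda>xs. g0 (xs ! 0) (xs ! 1))"
    and g2: "computable 4 (\<lambda>xs. g2 (xs ! 0) (xs ! 1) (xs ! 2) (xs ! 3))"
    and acc: "computable 2 (\<lambda>xs. of_bool (acc (xs ! 0) (xs ! 1)))"
    and N: "computable 1 (\<lambda>xs. N (xs ! 0))"
    and L: "\<And>i. i \<in> D \<Longrightarrow> L i = {T \<in> trees k. acc (enc i) (fold_btree (g0 (enc i)) (g2 (enc i)) T)}"
    and fin: "\<And>i. i \<in> D \<Longrightarrow> finite (fold_btree (g0 (enc i)) (g2 (enc i)) ` trees k)"
    and card: "\<And>i. i \<in> D \<Longrightarrow> card (fold_btree (g0 (enc i)) (g2 (enc i)) ` trees k) \<le> N (enc i)"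
  shows "decidable enc D (\<lambda>i. joint_embedding_property (\<preceq>) (L i))"
proof -
  define inL where "inL e x \<longleftrightarrow> tree_decode x \<in> trees k \<and> acc e (fold_btree (g0 e) (g2 e) (tree_decode x))" for e x
  define c where "c e = code_bound k (N e * 2 ^ ideal_bound k (N e) (N e))" for e
  define c' where "c' e = code_bound k (N e * 2 ^ Suc (c e))" for e
  define P where "P e \<longleftrightarrow> (\<exists>y<Suc (c' e). \<forall>x<Suc (c e). inL e x \<longrightarrow> inL e y \<and> tree_decode x \<preceq> tree_decode y)" for e
  have bound: "computable n (\<lambda>xs. code_bound k (G xs))" if "computable n G" for n G
    unfolding code_bound_def by (intro that comp_intro) simp_all
  have ib: "computable 1 (\<lambda>xs. ideal_bound k (N (xs ! 0)) (N (xs ! 0)))"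
    unfolding ideal_bound_def by (intro N comp_intro computable_comp1[OF N]) simp_all
  have c1: "computable 1 (\<lambda>xs. c (xs ! 0))"
    unfolding c_def by (intro N comp_intro bound ib)
  have c2: "computable 1 (\<lambda>xs. c' (xs ! 0))"
    unfolding c'_def by (intro N comp_intro bound c1)
  have inL: "decides n (\<lambda>xs. inL (E xs) (G xs))" if "computable n E" "computable n G" for n E G
    unfolding inL_def
  proof (intro decides_conj decides_labels that)
    show "decides n (\<lambda>xs. acc (E xs) (fold_btree (g0 (E xs)) (g2 (E xs)) (tree_decode (G xs))))"
      unfolding decides_def by (rule computable_comp2[OF acc]) (intro that computable_fold_btree g0 g2)+
  qed
  have "decides 1 (\<lambda>xs. P (xs ! 0))"
    unfolding P_def by (intro comp_intro inL c1 c2 computable_comp1[OF c1]) simp_all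
  then obtain f where f: "recursive_fn 1 f" "\<And>xs. length xs = 1 \<Longrightarrow> f xs = of_bool (P (xs ! 0))"
    unfolding decides_def computable_def by blast
  have "P (enc i) \<longleftrightarrow> joint_embedding_property (\<preceq>) (L i)" if i: "i \<in> D" for i
  proof -
    interpret tree_fold k "N (enc i)" "g0 (enc i)" "g2 (enc i)" "fold_btree (g0 (enc i)) (g2 (enc i))"
      by unfold_locales (use fin[OF i] card[OF i] in auto)
    have "L i = {T \<in> trees k. fold_btree (g0 (enc i)) (g2 (enc i)) T \<in> {q. acc (enc i) q}}"
      using L[OF i] by simp
    from JEP_iff_codes[OF this k refl]
    show ?thesis unfolding P_def c'_def c_def inL_def L[OF i] by simp
  qed
  then show ?thesis
    unfolding decidable_def using f by (intro exI[of _ f]) auto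
qed

theorem theorem1:
  fixes k :: nat
  assumes "k \<ge> 1"
  shows "decidable tree_set_encode {S. finite S \<and> S \<subseteq> trees k}
           (\<lambda>S. joint_embedding_property (\<preceq>) (Forb (\<preceq>) (trees k) S))
       \<and> decidable (automaton_encode k) {A. tree_automaton k A}
           (\<lambda>A. joint_embedding_property (\<preceq>) (language k A))"
proof
  \<comment> \<open>\<open>e\<close> codes \<open>S\<close>, and \<open>q\<close> codes the trees
    with code below \<open>e\<close> contained in the input. The bound on \<open>u\<close> loses no
    member of \<open>S\<close>, whose codes are all below \<open>e\<close>.\<close>
  define acc where "acc e q \<longleftrightarrow> (\<forall>u<e. mem_code u e \<longrightarrow> \<not> mem_code u q)" for e q
  show "decidable tree_set_encode {S. finite S \<and> S \<subseteq> trees k}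
      (\<lambda>S. joint_embedding_property (\<preceq>) (Forb (\<preceq>) (trees k) S))"
  proof (rule decidable_JEP[OF _ computable_contained])
    show "computable 2 (\<lambda>xs. of_bool (acc (xs ! 0) (xs ! 1)))"
      unfolding acc_def by (intro comp_intro) simp_all
    show "computable 1 (\<lambda>xs. 2 ^ (xs ! 0))" by (intro comp_intro) simp
    fix S :: "nat btree set"
    let ?e = "tree_set_encode S"
    let ?fold = "fold_btree (contained_leaf ?e) (contained_node ?e)"
    \<comment> \<open>A state codes a set of numbers below \<open>?e\<close>, hence the bound
      \<open>2 ^ ?e\<close>.\<close>
    have sub: "?fold ` trees k \<subseteq> set_encode ` Pow {..<?e}" unfolding fold_contained by auto
    then show "finite (?fold ` trees k)" by (rule finite_subset) simp
    have "card (?fold ` trees k) \<le> card (set_encode ` Pow {..<?e})"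
      by (rule card_mono[OF _ sub]) simp
    also have "\<dots> \<le> 2 ^ ?e" using card_image_le[of "Pow {..<?e}" set_encode] by (simp add: card_Pow)
    finally show "card (?fold ` trees k) \<le> 2 ^ ?e" .
    assume "S \<in> {S. finite S \<and> S \<subseteq> trees k}"
    then have fin: "finite (tree_encode ` S)" by simp
    have mem: "mem_code u ?e \<longleftrightarrow> u \<in> tree_encode ` S" for u
      using fin by (simp add: tree_set_encode_def)
    have less: "u < ?e" if "u \<in> tree_encode ` S" for u
    proof -
      \<comment> \<open>The member \<open>u\<close> contributes the summand \<open>2 ^ u\<close> to
        the code of the set.\<close>
      have "2 ^ u \<le> ?e"
        unfolding tree_set_encode_def set_encode_def using fin that by (intro member_le_sum) auto
      then show ?thesis using less_exp[of u] by linarith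
    qed
    have "acc ?e (?fold T) \<longleftrightarrow> (\<forall>Y\<in>S. \<not> Y \<preceq> T)" for T
    proof -
      have "mem_code u (?fold T) \<longleftrightarrow> u < ?e \<and> tree_decode u \<preceq> T" for u
        unfolding fold_contained by simp
      then have "acc ?e (?fold T) \<longleftrightarrow> (\<forall>u\<in>tree_encode ` S. \<not> tree_decode u \<preceq> T)"
        unfolding acc_def mem using less by blast
      then show ?thesis by simp
    qed
    then show "Forb (\<preceq>) (trees k) S = {T \<in> trees k. acc ?e (?fold T)}" by (simp add: Forb_def)
  qed (use assms in simp)
next
  define g0 where "g0 e x = nth_code (nth_code e 2) x" for e x
  \<comment> \<open>The transition table is listed lexicographically by \<open>(x, y, z)\<close>,
    which gives this position.\<close>
  define g2 where "g2 e x y z = nth_code (nth_code e 3)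
    (x * (nth_code e 0 * nth_code e 0) + (y * nth_code e 0 + z))" for e x y z
  show "decidable (automaton_encode k) {A. tree_automaton k A}
      (\<lambda>A. joint_embedding_property (\<preceq>) (language k A))"
  proof (rule decidable_JEP)
    show "computable 2 (\<lambda>xs. g0 (xs ! 0) (xs ! 1))" unfolding g0_def by (intro comp_intro) simp_all
    show "computable 4 (\<lambda>xs. g2 (xs ! 0) (xs ! 1) (xs ! 2) (xs ! 3))"
      unfolding g2_def by (intro comp_intro) simp_all
    show "computable 2 (\<lambda>xs. of_bool (mem_code (xs ! 1) (nth_code (xs ! 0) 1)))"
      by (intro comp_intro) simp_all
    show "computable 1 (\<lambda>xs. nth_code (xs ! 0) 0)" by (intro comp_intro) simp
    fix A assume "A \<in> {A. tree_automaton k A}"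
    then have A: "tree_automaton k A" by simp
    let ?e = "automaton_encode k A" and ?n = "num_states A"
    have e: "nth_code ?e 0 = ?n" "nth_code ?e 1 = set_encode (accepting A)"
      "nth_code ?e 2 = list_encode (map (m0 A) [0..<k])"
      "nth_code ?e 3 = list_encode (map (\<lambda>(x, y, z). m2 A x y z)
          (List.product [0..<k] (List.product [0..<?n] [0..<?n])))"
      unfolding automaton_encode_def Let_def by (subst nth_code_list_encode; simp)+
    have g0: "g0 ?e x = m0 A x" if "x < k" for x
      unfolding g0_def e using that by (subst nth_code_list_encode) auto
    have g2: "g2 ?e x y z = m2 A x y z" if "x < k" "y < ?n" "z < ?n" for x y z
    proof -
      have "y * ?n + z < Suc y * ?n" using that by simp
      also have "\<dots> \<le> ?n * ?n" using that by (intro mult_le_mono1) simp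
      finally have yz: "y * ?n + z < ?n * ?n" .
      have "x * (?n * ?n) + (y * ?n + z) < Suc x * (?n * ?n)" using yz by simp
      also have "\<dots> \<le> k * (?n * ?n)" using that by (intro mult_le_mono1) simp
      finally show ?thesis
        unfolding g2_def e using yz that
        by (subst nth_code_list_encode) (simp_all add: product_nth)
    qed
    have run: "fold_btree (g0 ?e) (g2 ?e) T = run A T" if "T \<in> trees k" for T
      using that by (induction T) (use g0 g2 run_less[OF A] in auto)
    have sub: "fold_btree (g0 ?e) (g2 ?e) ` trees k \<subseteq> {..<?n}" using run run_less[OF A] by auto
    then show "finite (fold_btree (g0 ?e) (g2 ?e) ` trees k)" by (rule finite_subset) simp
    show "card (fold_btree (g0 ?e) (g2 ?e) ` trees k) \<le> nth_code ?e 0"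
      using card_mono[OF _ sub] e by simp
    have "finite (accepting A)" using A by (auto simp: tree_automaton_def intro: finite_subset)
    then show "language k A = {T \<in> trees k. mem_code (fold_btree (g0 ?e) (g2 ?e) T) (nth_code ?e 1)}"
      unfolding language_def e using run by auto
  qed (use assms in simp)
qed

end
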